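(* The 7-dimensional Cohn-Elkies linear programming bound (i.e., the Cohn-Elkies linear programming bound in $\mathbb{R}^7$) is greater than $0.06374745$.
   Context: Fourier transform on $\mathbb{R}^d$: $\widehat f(y)=\int_{\mathbb{R}^d} f(x)e^{-2\pi i\langle x,y\rangle}\,dx$, where $\langle x,y\rangle=x_1y_1+\cdots+x_dy_d$. A function $f:\mathbb{R}^d\to\mathbb{R}$ is rapidly decreasing if $f(x)=O\left((1+|x|)^{-k}\right)$ for all positive integers $k$; it is radial if $f(x)$ depends only on $|x|$. For fixed $r>0$ and positive integer $d$, the Cohn-Elkies linear programming bound in $\mathbb{R}^d$ is the infimum of $\left(\frac r2\right)^d f(0)$ over all radial, smooth, rapidly decreasing functions $f:\mathbb{R}^d\to\mathbb{R}$ such that $f(0)>0$; $\widehat f(0)\geq 1$; $f(x)\leq 0$ for all $|x|\geq r$; and $\widehat f(y)\geq 0$ for all $y\in\mathbb{R}^d$. This value does not depend on $r$ (by rescaling $f$). *)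

theory Defs
  imports "HOL-Analysis.Analysis"
begin

text \<open>Since \<open>f\<close> is real-valued, its transform is in general complex-valued.\<close>

definition fourier :: "(real ^ 'n \<Rightarrow> real) \<Rightarrow> real ^ 'n \<Rightarrow> complex" where
  "fourier f y =
     (LINT x|lborel. complex_of_real (f x) * exp (- 2 * of_real pi * \<i> * of_real (x \<bullet> y)))"

definition radial :: "(real ^ 'n \<Rightarrow> real) \<Rightarrow> bool" where
  "radial f \<longleftrightarrow> (\<forall>x y. norm x = norm y \<longrightarrow> f x = f y)"

text \<open>
  The implied constant may depend on \<open>k\<close>. The bound is asked for near infinity; for
  continuous \<open>f\<close> this is the same as a bound on all of \<open>\<real>\<^sup>n\<close>.
\<close>

definition rapidly_decreasing :: "(real ^ 'n \<Rightarrow> real) \<Rightarrow> bool" where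
  "rapidly_decreasing f \<longleftrightarrow>
     (\<forall>k::nat. k > 0 \<longrightarrow> f \<in> O[at_infinity](\<lambda>x. 1 / (1 + norm x) ^ k))"

text \<open>
  \<open>Ck n f\<close> says that \<open>f\<close> is \<open>n\<close> times continuously differentiable. Passing to all
  directional derivatives \<open>x \<mapsto> Df(x)v\<close>, instead of to the derivative
  \<open>x \<mapsto> Df(x)\<close> itself, keeps the recursion within one type.
\<close>

primrec Ck :: "nat \<Rightarrow> (real ^ 'n \<Rightarrow> real) \<Rightarrow> bool" where
  "Ck 0 f \<longleftrightarrow> continuous_on UNIV f"
| "Ck (Suc n) f \<longleftrightarrow>
     (\<forall>x. f differentiable (at x)) \<and> (\<forall>v. Ck n (\<lambda>x. frechet_derivative f (at x) v))"

definition smooth :: "(real ^ 'n \<Rightarrow> real) \<Rightarrow> bool" where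
  "smooth f \<longleftrightarrow> (\<forall>n. Ck n f)"

text \<open>
  The order on the complex numbers is the one of \<open>Complex_Order\<close>: \<open>a \<le> z\<close> for real \<open>a\<close>
  means that \<open>z\<close> is real and at least \<open>a\<close>.
\<close>

definition admissible :: "real \<Rightarrow> (real ^ 'n \<Rightarrow> real) \<Rightarrow> bool" where
  "admissible r f \<longleftrightarrow>
     radial f \<and> smooth f \<and> rapidly_decreasing f \<and>
     f 0 > 0 \<and>
     fourier f 0 \<ge> 1 \<and>
     (\<forall>x. norm x \<ge> r \<longrightarrow> f x \<le> 0) \<and>
     (\<forall>y. fourier f y \<ge> 0)"

text \<open>
  The infimum is taken in the extended reals, where it is always well defined.
  The dimension is \<open>CARD('n)\<close>.
\<close>

definition cohn_elkies_bound :: "'n::finite itself \<Rightarrow> real \<Rightarrow> ereal" where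
  "cohn_elkies_bound _ r =
     (INF f \<in> {f :: real ^ 'n \<Rightarrow> real. admissible r f}. ereal ((r / 2) ^ CARD('n) * f 0))"

end

theory Submission
  imports Defs
begin

text \<open>
  The bound comes from linear programming duality. A feasible point of the dual program is a
  nonnegative measure that has an atom at the origin, is otherwise supported at distance at least
  \<open>r\<close>, and has a nonnegative Fourier transform. Integrating an admissible \<open>f\<close> against it gives at
  most the contribution of \<open>f(0)\<close>, because \<open>f \<le> 0\<close> on the rest of the support; computing the same
  integral on the Fourier side gives at least the contribution of \<open>fourier f 0 \<ge> 1\<close>. This bounds \<open>f(0)\<close>
  from below.

  Here the measure lives on the lattice \<open>h\<int>\<^sup>7\<close> with \<open>h = r/4\<close> and is periodic modulo \<open>8h\<int>\<^sup>7\<close>, so it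
  is a function \<open>w\<close> on the finite group \<open>(\<int>/8)\<^sup>7\<close>, and its Fourier transform is the discrete one.
  In units of \<open>h\<close>, the support condition says that a nonzero class may carry weight only if all its
  representatives have squared norm at least 16, and the resulting inequality is
  \<open>\<Sum> w \<le> (8h)\<^sup>7 w(0) f(0) = 4\<^sup>7 w(0) (r/2)\<^sup>7 f(0)\<close> (lemma \<open>discrete_dual_bound\<close>). One may average
  \<open>w\<close> over signed permutations of the coordinates, so \<open>w\<close> is taken to depend only on how often each
  of \<open>0, 1, 2, 3, 4\<close> occurs among the absolute values of the coordinates. There are 330 such
  profiles, and they index the variables as well as the constraints of a linear program; a numerical
  solution, moved slightly into the feasible region and rounded, is the table \<open>weight_table\<close>. Its
  total mass is \<open>1044.43824958625 w(0)\<close>, and \<open>0.06374745 \<sdot> 4\<^sup>7 = 1044.4382208\<close> is needed. The numerical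
  optimum exceeds this threshold by less than one part in \<open>10\<^sup>7\<close>, hence the many digits.

  Summation over a coset of \<open>8h\<int>\<^sup>7\<close> would naturally be turned into a Fourier sum by Poisson
  summation. It is simpler to smooth the periodic measure: replace each point mass by a periodic
  kernel that is nonnegative, is a trigonometric polynomial with nonnegative coefficients, and
  concentrates at the point. Against such a polynomial, \<open>f\<close> integrates to a finite combination of
  values of its Fourier transform, so no convergence question arises on the Fourier side
  (\<open>vp_prod_fourier_series\<close>); on the other side only an upper bound for the integral is needed,
  which follows from an elementary majorant of \<open>f\<close> (\<open>korovkin_domination\<close>).

  The nonnegativity of the discrete transform is an exact computation. Its values lie in
  \<open>\<int>[\<surd>2]\<close>, since they are real and, for integer weights, integer combinations of eighth roots of
  unity. They are obtained by summing out one coordinate at a time on the array of weights, indexed by profiles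
  (\<open>weighted_character_sum\<close>, \<open>transform_contract\<close>), for all frequencies with nondecreasing classes
  (\<open>dual_check_sound\<close>).
\<close>

section \<open>The de la Vallee Poussin kernel\<close>

text \<open>
  In the variable \<open>t = 2\<theta>\<close> this is the kernel of de la Vallee Poussin, normalised to have constant
  Fourier coefficient 1. The parity of the exponent makes it a polynomial in \<open>cos (2\<theta>)\<close>, so
  it has period \<open>\<pi>\<close>.
\<close>
definition vp_kernel :: "nat \<Rightarrow> real \<Rightarrow> real" where
  "vp_kernel N \<theta> = 4 ^ N / real (2 * N choose N) * cos \<theta> ^ (2 * N)"

definition vp_coeff :: "nat \<Rightarrow> nat \<Rightarrow> real" where
  "vp_coeff N j = real (2 * N choose j) / real (2 * N choose N)"

lemma vp_kernel_nonneg: "0 \<le> vp_kernel N \<theta>"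
  by (simp add: vp_kernel_def)

lemma vp_coeff_nonneg: "0 \<le> vp_coeff N j"
  by (simp add: vp_coeff_def)

lemma vp_coeff_self [simp]: "vp_coeff N N = 1"
  by (simp add: vp_coeff_def)

lemma vp_kernel_continuous [continuous_intros]:
  fixes A :: "'a::t2_space set"
  shows "continuous_on A g \<Longrightarrow> continuous_on A (\<lambda>x. vp_kernel N (g x))"
  unfolding vp_kernel_def by (intro continuous_intros)

text \<open>
  The binomial expansion of \<open>(exp(i\<theta>) + exp(-i\<theta>))\<close> to the power \<open>2N\<close> shows at once that all Fourier
  coefficients are nonnegative; this is what makes the kernel usable on the dual side.
\<close>
lemma vp_kernel_fourier_series:
  "complex_of_real (vp_kernel N \<theta>) =
     (\<Sum>j\<le>2*N. of_real (vp_coeff N j) * cis (2 * (real j - real N) * \<theta>))"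
proof -
  have "complex_of_real (2 * cos \<theta>) = cis \<theta> + cis (- \<theta>)"
    by (simp add: complex_eq_iff)
  then have "complex_of_real ((2 * cos \<theta>) ^ (2 * N)) = (cis \<theta> + cis (- \<theta>)) ^ (2 * N)"
    by (metis of_real_power)
  also have "\<dots> = (\<Sum>j\<le>2*N. of_nat (2 * N choose j) * cis (2 * (real j - real N) * \<theta>))"
    unfolding binomial_ring
  proof (intro sum.cong refl)
    fix j assume "j \<in> {..2*N}"
    then have "real j * \<theta> + real (2 * N - j) * (- \<theta>) = 2 * (real j - real N) * \<theta>"
      by (simp add: of_nat_diff algebra_simps)
    then have "cis \<theta> ^ j * cis (- \<theta>) ^ (2 * N - j) = cis (2 * (real j - real N) * \<theta>)"
      by (simp only: Complex.DeMoivre cis_mult)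
    then show "of_nat (2 * N choose j) * cis \<theta> ^ j * cis (- \<theta>) ^ (2 * N - j) =
        of_nat (2 * N choose j) * cis (2 * (real j - real N) * \<theta>)"
      by (simp add: mult.assoc)
  qed
  finally have "complex_of_real ((2 * cos \<theta>) ^ (2 * N)) / of_real (real (2 * N choose N)) =
      (\<Sum>j\<le>2*N. of_real (vp_coeff N j) * cis (2 * (real j - real N) * \<theta>))"
    by (simp add: vp_coeff_def sum_divide_distrib)
  moreover have "(2 * cos \<theta>) ^ (2 * N) / real (2 * N choose N) = vp_kernel N \<theta>"
    by (simp add: vp_kernel_def power_mult power_mult_distrib)
  ultimately show ?thesis
    by (metis of_real_divide)
qed

lemma vp_kernel_cos_series:
  "vp_kernel N \<theta> = (\<Sum>j\<le>2*N. vp_coeff N j * cos (2 * (real j - real N) * \<theta>))"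
  using arg_cong[OF vp_kernel_fourier_series[of N \<theta>], of Re] by simp

text \<open>
  Concentration of the kernel at the zeros of \<open>sin\<close> is measured by its second moment. Multiplying
  by \<open>cos\<^sup>2\<close> only raises the index by one, up to the ratio of two normalising constants, so the
  moment is exactly computable.
\<close>
lemma vp_kernel_times_sin_squared:
  "vp_kernel N \<theta> * (sin \<theta>)\<^sup>2 =
     vp_kernel N \<theta> - (1 - 1 / real (2 * N + 2)) * vp_kernel (Suc N) \<theta>"
proof -
  define b where "b = real (2 * N choose N)"
  have b: "b > 0" by (simp add: b_def)
  have 1: "Suc N * (2 * Suc N choose Suc N) = 2 * Suc (2*N) * (2 * N choose N)"
  proof -
    have "Suc N * (Suc (Suc (2 * N)) choose Suc N) = Suc (Suc (2*N)) * (Suc (2 * N) choose N)"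
      by (rule Suc_times_binomial)
    moreover have "Suc N * (Suc (2 * N) choose N) = Suc (2 * N) * (2 * N choose N)"
      using Suc_times_binomial[of N "2*N"] binomial_symmetric[of N "Suc (2*N)"]
      by simp
    ultimately have "Suc N * (Suc N * (2 * Suc N choose Suc N)) = Suc N * (2 * Suc (2*N) * (2 * N choose N))"
      by (simp add: algebra_simps)
    then show ?thesis by (metis mult_cancel1 nat.distinct(1))
  qed
  have 2: "real (2 * Suc N choose Suc N) = 2 * (2 * N + 1) * b / (N + 1)"
    using arg_cong[OF 1, of real] by (simp add: b_def field_simps)
  have "(1 - 1 / real (2 * N + 2)) * (4 ^ Suc N / real (2 * Suc N choose Suc N)) = 4 ^ N / b"
    unfolding 2 using b by (simp add: divide_simps) (simp add: algebra_simps)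
  then have "(1 - 1 / real (2 * N + 2)) * vp_kernel (Suc N) \<theta> = 4 ^ N / b * cos \<theta> ^ (2 * Suc N)"
    unfolding vp_kernel_def by (metis mult.assoc)
  also have "\<dots> = vp_kernel N \<theta> * (cos \<theta>)\<^sup>2"
    by (simp add: vp_kernel_def b_def power2_eq_square)
  finally show ?thesis
    by (simp add: sin_squared_eq right_diff_distrib)
qed

text \<open>
  A primitive of the kernel, rescaled to period \<open>L\<close> and centred at \<open>c\<close>. The frequency \<open>j = N\<close> is the
  constant term and accounts for the summand \<open>t\<close>.
\<close>
definition vp_primitive :: "nat \<Rightarrow> real \<Rightarrow> real \<Rightarrow> real \<Rightarrow> real" where
  "vp_primitive N L c t = t + (\<Sum>j\<in>{..2*N}-{N}. vp_coeff N j *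
      (L / (2 * pi * (real j - real N))) * sin (2 * (real j - real N) * (pi * (t - c) / L)))"

lemma vp_primitive_deriv:
  assumes "L > 0"
  shows "(vp_primitive N L c has_real_derivative vp_kernel N (pi * (t - c) / L)) (at t)"
proof -
  have *: "vp_kernel N \<theta> = 1 + (\<Sum>j\<in>{..2*N}-{N}. vp_coeff N j * cos (2 * (real j - real N) * \<theta>))" for \<theta>
    unfolding vp_kernel_cos_series by (subst sum.remove[of _ N]) auto
  show ?thesis
    unfolding vp_primitive_def[abs_def] *
    by (rule derivative_eq_intros refl sum.cong | simp add: assms less_imp_neq[THEN not_sym])+
qed

lemma vp_primitive_period:
  assumes "L > 0"
  shows "vp_primitive N L c (L / 2) - vp_primitive N L c (- L / 2) = L"
proof -
  have "sin (2 * (real j - real N) * (pi * (L / 2 - c) / L)) =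
        sin (2 * (real j - real N) * (pi * (- L / 2 - c) / L))" for j
  proof -
    have "2 * (real j - real N) * (pi * (L / 2 - c) / L) =
        2 * (real j - real N) * (pi * (- L / 2 - c) / L) + 2 * pi * of_int (int j - int N)"
      using assms by (simp add: field_simps)
    then show ?thesis
      by (metis (no_types, lifting) sin_cos_eq_iff sin_add sin_int_2pin cos_int_2pin mult.right_neutral mult_zero_right add.right_neutral)
  qed
  then show ?thesis
    unfolding vp_primitive_def by simp
qed

lemma nn_integral_vp_kernel:
  assumes "L > 0"
  shows "(\<integral>\<^sup>+t. ennreal (vp_kernel N (pi * (t - c) / L)) * indicator {-L/2..L/2} t \<partial>lborel) = ennreal L"
proof -
  have "(\<integral>\<^sup>+t. ennreal (vp_kernel N (pi * (t - c) / L)) * indicator {-L/2..L/2} t \<partial>lborel) =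
     ennreal (vp_primitive N L c (L / 2) - vp_primitive N L c (- L / 2))"
    using assms
    by (intro nn_integral_FTC_Icc)
       (auto intro!: borel_measurable_continuous_onI continuous_intros vp_kernel_nonneg
          vp_primitive_deriv)
  then show ?thesis using vp_primitive_period[OF assms] by simp
qed

lemma nn_integral_vp_kernel_sin_squared:
  assumes "L > 0"
  shows "(\<integral>\<^sup>+t. ennreal (vp_kernel N (pi * (t - c) / L) * (sin (pi * (t - c) / L))\<^sup>2) *
      indicator {-L/2..L/2} t \<partial>lborel) = ennreal (L / real (2 * N + 2))"
proof -
  define \<rho> where "\<rho> = 1 - 1 / real (2 * N + 2)"
  define P where "P t = vp_primitive N L c t - \<rho> * vp_primitive (Suc N) L c t" for t
  have "(\<integral>\<^sup>+t. ennreal (vp_kernel N (pi * (t - c) / L) * (sin (pi * (t - c) / L))\<^sup>2) *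
      indicator {-L/2..L/2} t \<partial>lborel) = ennreal (P (L / 2) - P (- L / 2))"
  proof (intro nn_integral_FTC_Icc)
    show "(P has_real_derivative vp_kernel N (pi * (t - c) / L) * (sin (pi * (t - c) / L))\<^sup>2) (at t)" for t
      unfolding P_def[abs_def] vp_kernel_times_sin_squared \<rho>_def
      by (intro DERIV_diff DERIV_cmult vp_primitive_deriv assms)
  qed (use assms in \<open>auto intro!: borel_measurable_continuous_onI continuous_intros
      mult_nonneg_nonneg vp_kernel_nonneg\<close>)
  also have "P (L / 2) - P (- L / 2) =
      (vp_primitive N L c (L / 2) - vp_primitive N L c (- L / 2)) -
      \<rho> * (vp_primitive (Suc N) L c (L / 2) - vp_primitive (Suc N) L c (- L / 2))"
    unfolding P_def right_diff_distrib by linarith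
  also have "\<dots> = L / real (2 * N + 2)"
    unfolding vp_primitive_period[OF assms] \<rho>_def by (simp add: left_diff_distrib)
  finally show ?thesis .
qed

section \<open>The product kernel on a cell\<close>

lemma nn_integral_vec_prod:
  fixes g :: "'n::finite \<Rightarrow> real \<Rightarrow> ennreal"
  assumes "\<And>i. g i \<in> borel_measurable borel"
  shows "(\<integral>\<^sup>+x. (\<Prod>i\<in>UNIV. g i (x $ i)) \<partial>(lborel :: (real^'n) measure)) = (\<Prod>i\<in>UNIV. \<integral>\<^sup>+t. g i t \<partial>lborel)"
proof -
  have B: "(Basis :: (real^'n) set) = (\<lambda>i. axis i 1) ` UNIV"
    by (auto simp: Basis_vec_def)
  have inj: "inj (\<lambda>i::'n. axis i (1::real))"
    by (auto simp: inj_def axis_eq_axis)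
  have "(\<integral>\<^sup>+x. (\<Prod>b\<in>Basis. g (axis_index b) (x \<bullet> b)) \<partial>(lborel :: (real^'n) measure)) =
      (\<Prod>b\<in>(Basis :: (real^'n) set). \<integral>\<^sup>+t. g (axis_index b) t \<partial>lborel)"
    by (intro nn_integral_lborel_prod) (auto intro: assms)
  then show ?thesis
    unfolding B prod.reindex[OF inj] by (simp add: inner_axis axis_index_axis)
qed

text \<open>A closed fundamental domain of \<open>L\<int>\<^sup>n\<close>, centred so that it contains the ball of radius \<open>L/2\<close>.\<close>
abbreviation cell :: "real \<Rightarrow> (real ^ 'n) set" where
  "cell L \<equiv> cbox (\<chi> i. - L / 2) (\<chi> i. L / 2)"

definition vp_prod :: "nat \<Rightarrow> real \<Rightarrow> real ^ 'n \<Rightarrow> real ^ 'n \<Rightarrow> real" where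
  "vp_prod N L c x = (\<Prod>i\<in>UNIV. vp_kernel N (pi * (x $ i - c $ i) / L))"

lemma has_integral_cell_prod:
  fixes g :: "'n::finite \<Rightarrow> real \<Rightarrow> real" and I :: "'n \<Rightarrow> real"
  assumes cont: "\<And>i. continuous_on UNIV (g i)"
    and nonneg: "\<And>i t. 0 \<le> g i t" "\<And>i. 0 \<le> I i"
    and int: "\<And>i. (\<integral>\<^sup>+t. ennreal (g i t) * indicator {- L / 2..L / 2} t \<partial>lborel) = ennreal (I i)"
  shows "has_bochner_integral lborel
    (\<lambda>x :: real ^ 'n. indicator (cell L) x * (\<Prod>i\<in>UNIV. g i (x $ i))) (\<Prod>i\<in>UNIV. I i)"
proof (rule has_bochner_integral_nn_integral)
  have m [measurable]: "g i \<in> borel_measurable borel" for i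
    by (rule borel_measurable_continuous_onI[OF cont])
  have eq: "ennreal (indicator (cell L) x * (\<Prod>i\<in>UNIV. g i (x $ i))) =
      (\<Prod>i\<in>UNIV. ennreal (g i (x $ i)) * indicator {- L / 2..L / 2} (x $ i))" for x :: "real ^ 'n"
  proof (cases "x \<in> cell L")
    case True
    then show ?thesis
      by (auto simp: mem_box_cart prod_ennreal nonneg)
  next
    case False
    then obtain i where "x $ i \<notin> {- L / 2..L / 2}"
      by (auto simp: mem_box_cart)
    then have "(\<Prod>i\<in>UNIV. ennreal (g i (x $ i)) * indicator {- L / 2..L / 2} (x $ i)) = 0"
      by (intro prod_zero) (auto intro!: exI[of _ i])
    with False show ?thesis by simp
  qed
  show "(\<integral>\<^sup>+ x. ennreal (indicator (cell L) x * (\<Prod>i\<in>UNIV. g i (x $ i))) \<partial>lborel) =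
      ennreal (\<Prod>i\<in>UNIV. I i)"
    unfolding eq by (subst nn_integral_vec_prod) (simp_all only: int prod_ennreal nonneg, measurable)
  show "(\<lambda>x :: real ^ 'n. indicator (cell L) x * (\<Prod>i\<in>UNIV. g i (x $ i))) \<in> borel_measurable lborel"
    by measurable
  show "AE x :: real ^ 'n in lborel. 0 \<le> indicator (cell L) x * (\<Prod>i\<in>UNIV. g i (x $ i))"
    by (auto intro!: mult_nonneg_nonneg prod_nonneg nonneg)
qed (auto intro: prod_nonneg nonneg)

lemma vp_prod_nonneg: "0 \<le> vp_prod N L c x"
  unfolding vp_prod_def by (intro prod_nonneg vp_kernel_nonneg ballI)

lemma vp_prod_continuous: "L > 0 \<Longrightarrow> continuous_on A (vp_prod N L c)"
  unfolding vp_prod_def by (intro continuous_intros) auto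

lemma vp_prod_integral:
  fixes c :: "real ^ 'n"
  assumes "L > 0"
  shows "has_bochner_integral lborel (\<lambda>x. indicator (cell L) x * vp_prod N L c x) (L ^ CARD('n))"
proof -
  have "has_bochner_integral lborel
    (\<lambda>x :: real ^ 'n. indicator (cell L) x * (\<Prod>i\<in>UNIV. vp_kernel N (pi * (x $ i - c $ i) / L)))
    (\<Prod>i\<in>(UNIV :: 'n set). L)"
    by (intro has_integral_cell_prod nn_integral_vp_kernel)
       (use assms in \<open>auto intro!: continuous_intros vp_kernel_nonneg\<close>)
  then show ?thesis by (simp add: vp_prod_def)
qed

lemma vp_prod_sin_squared_integral:
  fixes c :: "real ^ 'n"
  assumes "L > 0"
  shows "has_bochner_integral lborel
    (\<lambda>x. indicator (cell L) x * (vp_prod N L c x * (sin (pi * (x $ k - c $ k) / L))\<^sup>2))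
    (L ^ CARD('n) / real (2 * N + 2))"
proof -
  define g where "g i t = vp_kernel N (pi * (t - c $ i) / L) *
    (if i = k then (sin (pi * (t - c $ i) / L))\<^sup>2 else 1)" for i t
  define I where "I i = (if i = k then L / real (2 * N + 2) else L)" for i
  have "has_bochner_integral lborel
    (\<lambda>x :: real ^ 'n. indicator (cell L) x * (\<Prod>i\<in>UNIV. g i (x $ i))) (\<Prod>i\<in>UNIV. I i)"
  proof (rule has_integral_cell_prod)
    fix i
    show "(\<integral>\<^sup>+t. ennreal (g i t) * indicator {- L / 2..L / 2} t \<partial>lborel) = ennreal (I i)"
      using nn_integral_vp_kernel[OF assms, of N "c $ i"]
        nn_integral_vp_kernel_sin_squared[OF assms, of N "c $ i"]
      by (cases "i = k") (simp_all add: g_def I_def)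
    show "continuous_on UNIV (g i)"
      using assms unfolding g_def[abs_def] by (cases "i = k") (auto intro!: continuous_intros)
  qed (use assms in \<open>auto simp: g_def I_def vp_kernel_nonneg\<close>)
  moreover have "(\<Prod>i\<in>UNIV. g i (x $ i)) = vp_prod N L c x * (sin (pi * (x $ k - c $ k) / L))\<^sup>2"
    for x :: "real ^ 'n"
    unfolding g_def prod.distrib vp_prod_def by (simp add: prod.delta)
  moreover have "(\<Prod>i\<in>UNIV. I i) = L ^ CARD('n) / real (2 * N + 2)"
    using prod.remove[of UNIV k I] assms power_Suc[of L "CARD('n) - 1"]
    by (simp add: I_def prod.If_cases card_Diff_singleton)
  ultimately show ?thesis by simp
qed

text \<open>
  The sum of squares on the right vanishes exactly on the lattice coset \<open>c + L\<int>\<^sup>n\<close>, where \<open>f \<le> b\<close>.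
  Elsewhere on the compact cell, wherever \<open>f\<close> is at least \<open>b + \<epsilon>\<close>, the sum of squares is bounded
  away from zero, so a large multiple of it dominates \<open>f\<close>. As in Korovkin's theorem, the integral of
  this one test function against the kernels then controls the limit for all continuous \<open>f\<close>.
\<close>
lemma korovkin_domination:
  fixes f :: "real ^ 'n \<Rightarrow> real" and c :: "real ^ 'n" and L b \<epsilon> :: real
  assumes cont: "continuous_on UNIV f" and "L > 0" "\<epsilon> > 0"
    and lattice: "\<And>p. (\<And>i. \<exists>z::int. p $ i = c $ i + L * z) \<Longrightarrow> f p \<le> b"
  obtains C where "C \<ge> 0"
    "\<And>x. x \<in> cell L \<Longrightarrow> f x \<le> b + \<epsilon> + C * (\<Sum>i\<in>UNIV. (sin (pi * (x $ i - c $ i) / L))\<^sup>2)"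
proof -
  define s where "s x = (\<Sum>i\<in>UNIV. (sin (pi * (x $ i - c $ i) / L))\<^sup>2)" for x :: "real ^ 'n"
  define S where "S = cell L \<inter> {x. b + \<epsilon> \<le> f x}"
  have s0: "0 \<le> s x" for x unfolding s_def by (intro sum_nonneg) auto
  have sc: "continuous_on A s" for A
    unfolding s_def[abs_def] using \<open>L > 0\<close> by (intro continuous_intros) auto
  have "closed {x. b + \<epsilon> \<le> f x}"
    by (intro closed_Collect_le cont continuous_intros)
  then have S: "compact S"
    unfolding S_def by (intro compact_Int_closed compact_cbox)
  have pos: "s x > 0" if "x \<in> S" for x
  proof (rule ccontr)
    assume "\<not> 0 < s x"
    then have "s x = 0" using s0[of x] by simp
    then have sin0: "sin (pi * (x $ i - c $ i) / L) = 0" for i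
      unfolding s_def by (subst (asm) sum_nonneg_eq_0_iff) auto
    have "\<exists>z::int. x $ i = c $ i + L * z" for i
    proof -
      have "sin ((x $ i - c $ i) / L * pi) = 0"
        using sin0[of i] by (simp add: mult.commute)
      then obtain z :: int where "(x $ i - c $ i) / L = z"
        unfolding sin_times_pi_eq_0 by (auto elim: Ints_cases)
      then have "x $ i = c $ i + L * z"
        using \<open>L > 0\<close> by (simp add: field_simps)
      then show ?thesis ..
    qed
    then have "f x \<le> b" by (rule lattice)
    with that \<open>\<epsilon> > 0\<close> show False by (simp add: S_def)
  qed
  show thesis
  proof (cases "S = {}")
    case True
    then have "f x \<le> b + \<epsilon>" if "x \<in> cell L" for x :: "real ^ 'n"
      using that by (force simp: S_def)
    then show thesis
      by (intro that[of 0]) simp_all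
  next
    case False
    obtain x0 where x0: "x0 \<in> S" "\<And>x. x \<in> S \<Longrightarrow> s x0 \<le> s x"
      using continuous_attains_inf[OF S False sc] by blast
    obtain x1 where x1: "\<And>x. x \<in> S \<Longrightarrow> f x \<le> f x1"
      using continuous_attains_sup[OF S False continuous_on_subset[OF cont]] by blast
    define C where "C = \<bar>f x1 - b - \<epsilon>\<bar> / s x0"
    have C: "C \<ge> 0" using s0 by (simp add: C_def)
    show thesis
    proof (rule that[OF C])
      fix x :: "real ^ 'n" assume x: "x \<in> cell L"
      show "f x \<le> b + \<epsilon> + C * (\<Sum>i\<in>UNIV. (sin (pi * (x $ i - c $ i) / L))\<^sup>2)"
      proof (cases "x \<in> S")
        case True
        have "f x - b - \<epsilon> \<le> C * s x0"
          using x1[OF True] pos[OF x0(1)] by (simp add: C_def)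
        also have "\<dots> \<le> C * s x"
          using x0(2)[OF True] C by (rule mult_left_mono)
        finally show ?thesis by (simp add: s_def)
      next
        case False
        then have "f x \<le> b + \<epsilon>" using x by (auto simp: S_def)
        moreover have "0 \<le> C * s x" using C s0 by simp
        ultimately show ?thesis by (simp add: s_def)
      qed
    qed
  qed
qed

lemma integrable_mult_continuous_bounded:
  fixes f g :: "real ^ 'n \<Rightarrow> real"
  assumes "integrable lborel f" "continuous_on UNIV g" "\<And>x. \<bar>g x\<bar> \<le> B"
  shows "integrable lborel (\<lambda>x. f x * g x)"
proof (rule Bochner_Integration.integrable_bound)
  show "integrable lborel (\<lambda>x. B * f x)" using assms(1) by simp
  have "g \<in> borel_measurable borel" by (rule borel_measurable_continuous_onI[OF assms(2)])
  then show "(\<lambda>x. f x * g x) \<in> borel_measurable lborel"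
    using borel_measurable_integrable[OF assms(1)] by measurable
  show "AE x in lborel. norm (f x * g x) \<le> norm (B * f x)"
  proof (intro AE_I2)
    fix x
    have "\<bar>g x\<bar> \<le> \<bar>B\<bar>" using assms(3)[of x] by linarith
    then show "norm (f x * g x) \<le> norm (B * f x)"
      using mult_right_mono[of "\<bar>g x\<bar>" "\<bar>B\<bar>" "\<bar>f x\<bar>"] by (simp add: abs_mult mult.commute)
  qed
qed

lemma integrable_vp_prod:
  fixes f :: "real ^ 'n \<Rightarrow> real"
  assumes "integrable lborel f" "L > 0"
  shows "integrable lborel (\<lambda>x. f x * vp_prod N L c x)"
proof (rule integrable_mult_continuous_bounded[OF assms(1) vp_prod_continuous[OF assms(2)]])
  fix x
  have "\<bar>vp_kernel N \<theta>\<bar> \<le> 4 ^ N / real (2 * N choose N)" for \<theta>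
    using mult_left_mono[OF power_le_one[of "\<bar>cos \<theta>\<bar>" "2 * N"], of "4 ^ N / real (2 * N choose N)"]
    by (simp add: vp_kernel_def abs_mult power_abs)
  then show "\<bar>vp_prod N L c x\<bar> \<le> (\<Prod>i\<in>(UNIV :: 'n set). 4 ^ N / real (2 * N choose N))"
    unfolding vp_prod_def abs_prod by (intro prod_mono) auto
qed

text \<open>
  One half of the limit of \<open>\<integral> f K\<close> for kernels \<open>K\<close> concentrating on \<open>c + L\<int>\<^sup>n\<close>: outside the cell the
  integrand is nonpositive, and inside it \<open>f\<close> is dominated by the Korovkin majorant, whose
  integral is explicit and whose error term is \<open>O(1/N)\<close>.
\<close>
lemma vp_prod_upper_bound:
  fixes f :: "real ^ 'n \<Rightarrow> real" and c :: "real ^ 'n" and L b \<epsilon> :: real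
  assumes cont: "continuous_on UNIV f" and int: "integrable lborel f" and "L > 0" "\<epsilon> > 0"
    and outside: "\<And>x. x \<notin> cell L \<Longrightarrow> f x \<le> 0"
    and lattice: "\<And>p. (\<And>i. \<exists>z::int. p $ i = c $ i + L * z) \<Longrightarrow> f p \<le> b"
  shows "\<exists>X::real. \<forall>N. (LINT x|lborel. f x * vp_prod N L c x) \<le> L ^ CARD('n) * (b + \<epsilon>) + X / real (2 * N + 2)"
proof -
  obtain C where C: "C \<ge> 0"
    "\<And>x. x \<in> cell L \<Longrightarrow> f x \<le> b + \<epsilon> + C * (\<Sum>i\<in>UNIV. (sin (pi * (x $ i - c $ i) / L))\<^sup>2)"
    using korovkin_domination[OF cont \<open>L > 0\<close> \<open>\<epsilon> > 0\<close> lattice] by blast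
  have "(LINT x|lborel. f x * vp_prod N L c x) \<le>
      L ^ CARD('n) * (b + \<epsilon>) + (C * CARD('n) * L ^ CARD('n)) / real (2 * N + 2)" for N
  proof -
    define I where "I = (indicator (cell L) :: real ^ 'n \<Rightarrow> real)"
    define K where "K = vp_prod N L c"
    define s where "s i x = (sin (pi * (x $ i - c $ i) / L))\<^sup>2" for i and x :: "real ^ 'n"
    have bound: "has_bochner_integral lborel
        (\<lambda>x. (b + \<epsilon>) * (I x * K x) + C * (\<Sum>i\<in>UNIV. I x * (K x * s i x)))
        ((b + \<epsilon>) * L ^ CARD('n) + C * (\<Sum>i\<in>(UNIV :: 'n set). L ^ CARD('n) / real (2 * N + 2)))"
      unfolding I_def K_def s_def
      by (intro has_bochner_integral_add has_bochner_integral_mult_right has_bochner_integral_sum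
          vp_prod_integral vp_prod_sin_squared_integral \<open>L > 0\<close>)
    have "f x * K x \<le> (b + \<epsilon>) * (I x * K x) + C * (\<Sum>i\<in>UNIV. I x * (K x * s i x))" for x
    proof (cases "x \<in> cell L")
      case True
      have "f x * K x \<le> (b + \<epsilon> + C * (\<Sum>i\<in>UNIV. s i x)) * K x"
        using C(2)[OF True] by (intro mult_right_mono) (auto simp: K_def s_def vp_prod_nonneg)
      with True show ?thesis
        by (simp add: I_def algebra_simps sum_distrib_left)
    next
      case False
      then show ?thesis
        using outside[OF False] by (simp add: I_def K_def mult_nonpos_nonneg vp_prod_nonneg)
    qed
    then have "(LINT x|lborel. f x * K x) \<le>
        (LINT x|lborel. (b + \<epsilon>) * (I x * K x) + C * (\<Sum>i\<in>UNIV. I x * (K x * s i x)))"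
      using integrable_vp_prod[OF int \<open>L > 0\<close>] integrable.intros[OF bound]
      by (intro integral_mono) (simp_all add: K_def)
    also have "\<dots> = (b + \<epsilon>) * L ^ CARD('n) + C * (\<Sum>i\<in>(UNIV :: 'n set). L ^ CARD('n) / real (2 * N + 2))"
      by (rule has_bochner_integral_integral_eq[OF bound])
    finally have "(LINT x|lborel. f x * K x) \<le>
        (b + \<epsilon>) * L ^ CARD('n) + C * (\<Sum>i\<in>(UNIV :: 'n set). L ^ CARD('n) / real (2 * N + 2))" .
    then show ?thesis
      by (simp add: K_def mult.commute mult.left_commute)
  qed
  then show ?thesis by blast
qed

section \<open>Weak duality for periodic measures on a lattice\<close>

text \<open>
  Integrating \<open>f\<close> against a character of the torus \<open>\<real>\<^sup>n / L\<int>\<^sup>n\<close> gives a value of its Fourier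
  transform on the dual lattice.
\<close>
lemma fourier_pairing:
  fixes f :: "real ^ 'n \<Rightarrow> real" and k :: "'n \<Rightarrow> int" and L :: real
  shows "fourier f (\<chi> i. - k i / L) =
    (LINT x|lborel. complex_of_real (f x) * cis (2 * pi * (\<Sum>i\<in>UNIV. k i * x $ i) / L))"
  unfolding fourier_def
proof (intro Bochner_Integration.integral_cong refl)
  fix x :: "real ^ 'n"
  have "x \<bullet> (\<chi> i. - k i / L) = - ((\<Sum>i\<in>UNIV. k i * x $ i) / L)"
    by (simp add: inner_vec_def sum_divide_distrib sum_negf mult.commute)
  then have "- 2 * of_real pi * \<i> * of_real (x \<bullet> (\<chi> i. - k i / L)) =
      \<i> * of_real (2 * pi * (\<Sum>i\<in>UNIV. k i * x $ i) / L)"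
    by simp
  then show "complex_of_real (f x) * exp (- 2 * of_real pi * \<i> * of_real (x \<bullet> (\<chi> i. - k i / L))) =
      complex_of_real (f x) * cis (2 * pi * (\<Sum>i\<in>UNIV. k i * x $ i) / L)"
    by (simp only: cis_conv_exp)
qed

lemma cis_sum: "finite A \<Longrightarrow> (\<Prod>i\<in>A. cis (g i)) = cis (\<Sum>i\<in>A. g i)"
  by (induction A rule: finite_induct) (simp_all add: cis_mult)

lemma vp_prod_fourier_series:
  fixes x c :: "real ^ 'n" and L :: real
  shows "complex_of_real (vp_prod N L c x) =
    (\<Sum>J\<in>PiE UNIV (\<lambda>_. {..2*N}). of_real (\<Prod>i\<in>UNIV. vp_coeff N (J i)) *
       (cis (- (2 * pi * (\<Sum>i\<in>UNIV. (int (J i) - int N) * c $ i) / L)) *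
        cis (2 * pi * (\<Sum>i\<in>UNIV. (int (J i) - int N) * x $ i) / L)))"
proof -
  have "complex_of_real (vp_prod N L c x) =
    (\<Sum>J\<in>PiE UNIV (\<lambda>_. {..2*N}). \<Prod>i\<in>UNIV. of_real (vp_coeff N (J i)) *
       cis (2 * (real (J i) - real N) * (pi * (x $ i - c $ i) / L)))"
    unfolding vp_prod_def of_real_prod vp_kernel_fourier_series by (rule prod_sum_PiE) auto
  also have "\<dots> = (\<Sum>J\<in>PiE UNIV (\<lambda>_. {..2*N}). of_real (\<Prod>i\<in>UNIV. vp_coeff N (J i)) *
       (cis (- (2 * pi * (\<Sum>i\<in>UNIV. (int (J i) - int N) * c $ i) / L)) *
        cis (2 * pi * (\<Sum>i\<in>UNIV. (int (J i) - int N) * x $ i) / L)))"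
  proof (intro sum.cong refl)
    fix J :: "'n \<Rightarrow> nat"
    have "(\<Sum>i\<in>UNIV. 2 * (real (J i) - real N) * (pi * (x $ i - c $ i) / L)) =
        - (2 * pi * (\<Sum>i\<in>UNIV. (int (J i) - int N) * c $ i) / L) +
        2 * pi * (\<Sum>i\<in>UNIV. (int (J i) - int N) * x $ i) / L"
      unfolding sum_distrib_left sum_divide_distrib sum_negf[symmetric] sum.distrib[symmetric]
      by (intro sum.cong refl) (simp add: algebra_simps add_divide_distrib diff_divide_distrib)
    then show "(\<Prod>i\<in>UNIV. of_real (vp_coeff N (J i)) *
          cis (2 * (real (J i) - real N) * (pi * (x $ i - c $ i) / L))) =
        of_real (\<Prod>i\<in>UNIV. vp_coeff N (J i)) *
         (cis (- (2 * pi * (\<Sum>i\<in>UNIV. (int (J i) - int N) * c $ i) / L)) *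
          cis (2 * pi * (\<Sum>i\<in>UNIV. (int (J i) - int N) * x $ i) / L))"
      unfolding prod.distrib cis_mult cis_sum[OF finite] by simp
  qed
  finally show ?thesis .
qed

text \<open>
  Weak duality for the measure that gives weight \<open>w v\<close> to every point of \<open>h(v + m\<int>\<^sup>n)\<close>. The
  two estimates of the smoothed pairing meet: on the Fourier side every term is a product of nonnegative numbers, and dropping all but the constant frequency leaves
  \<open>\<Sum> w\<close> times the transform of \<open>f\<close> at 0; on the other side the limit of the smoothing is at most
  \<open>(mh)\<^sup>n w(v) f(0)\<close> for a class that contains the origin and at most 0 for any other. The condition
  \<open>2 r \<le> m h\<close> makes the ball on which \<open>f\<close> may be positive fit into a single cell.
\<close>
lemma discrete_dual_bound:
  fixes f :: "real ^ 'n \<Rightarrow> real" and V :: "('n \<Rightarrow> int) set" and w :: "('n \<Rightarrow> int) \<Rightarrow> real"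
    and m :: nat and h r :: real
  assumes cont: "continuous_on UNIV f"
    and fourier_0: "fourier f 0 \<ge> 1" and fourier_nonneg: "\<And>y. fourier f y \<ge> 0"
    and f_0: "0 \<le> f 0" and sign: "\<And>x. norm x \<ge> r \<Longrightarrow> f x \<le> 0"
    and "m > 0" "h > 0" and cell: "2 * r \<le> m * h"
    and V: "finite V" "\<And>v. v \<in> V \<Longrightarrow> 0 \<le> w v"
    and far: "\<And>v z. v \<in> V \<Longrightarrow> w v \<noteq> 0 \<Longrightarrow> (\<And>i. int m dvd z i - v i) \<Longrightarrow> z \<noteq> (\<lambda>_. 0) \<Longrightarrow>
      r \<le> h * norm (\<chi> i. real_of_int (z i))"
    and dual: "\<And>k :: 'n \<Rightarrow> int.
      0 \<le> (\<Sum>v\<in>V. of_real (w v) * cis (- (2 * pi * (\<Sum>i\<in>UNIV. k i * v i) / m)))"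
  shows "(\<Sum>v\<in>V. w v) \<le> (m * h) ^ CARD('n) * (\<Sum>v\<in>{v\<in>V. \<forall>i. int m dvd v i}. w v) * f 0"
proof -
  define L where "L = m * h"
  have "L > 0" using \<open>m > 0\<close> \<open>h > 0\<close> by (simp add: L_def)
  define c where "c v = (\<chi> i. h * real_of_int (v i))" for v :: "'n \<Rightarrow> int"
  define b where "b v = (if \<forall>i. int m dvd v i then f 0 else 0)" for v :: "'n \<Rightarrow> int"

  have int: "integrable lborel f"
  proof (rule ccontr)
    \<comment> \<open>The integral of a function that is not integrable is 0 by convention.\<close>
    assume "\<not> integrable lborel f"
    then have "fourier f 0 = 0"
      unfolding fourier_def
      by (intro not_integrable_integral_eq) (simp add: complex_of_real_integrable_eq)
    with fourier_0 show False by (simp add: less_eq_complex_def)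
  qed

  have lower: "(\<Sum>v\<in>V. w v) \<le> (\<Sum>v\<in>V. w v * (LINT x|lborel. f x * vp_prod N L (c v) x))" for N
  proof -
    define E where "E = PiE (UNIV :: 'n set) (\<lambda>_. {..2*N})"
    define k where "k J i = int (J i) - int N" for J :: "'n \<Rightarrow> nat" and i
    define a where "a J = (\<Prod>i\<in>UNIV. vp_coeff N (J i))" for J :: "'n \<Rightarrow> nat"
    define W where "W J = (\<Sum>v\<in>V. of_real (w v) * cis (- (2 * pi * (\<Sum>i\<in>UNIV. k J i * v i) / m)))" for J
    define e where "e J x = cis (2 * pi * (\<Sum>i\<in>UNIV. k J i * x $ i) / L)" for J and x :: "real ^ 'n"
    \<comment> \<open>The index of the constant term of the kernel.\<close>
    define J0 where "J0 = (\<lambda>_ :: 'n. N)"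
    have "finite E" unfolding E_def by (intro finite_PiE) auto
    have "J0 \<in> E" by (simp add: J0_def E_def PiE_iff)
    have int_e: "integrable lborel (\<lambda>x. complex_of_real (f x) * e J x)" for J
    proof (rule Bochner_Integration.integrable_bound[OF int])
      have "e J \<in> borel_measurable borel"
        unfolding e_def[abs_def] cis_conv_exp using \<open>L > 0\<close>
        by (intro borel_measurable_continuous_onI continuous_intros) auto
      then show "(\<lambda>x. complex_of_real (f x) * e J x) \<in> borel_measurable lborel"
        using borel_measurable_integrable[OF int] by measurable
    qed (simp add: e_def norm_mult)
    have phase: "cis (- (2 * pi * (\<Sum>i\<in>UNIV. k J i * c v $ i) / L)) =
        cis (- (2 * pi * (\<Sum>i\<in>UNIV. k J i * v i) / m))" for J v
    proof -
      have "(\<Sum>i\<in>UNIV. k J i * c v $ i) = h * of_int (\<Sum>i\<in>UNIV. k J i * v i)"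
        by (simp add: c_def sum_distrib_left algebra_simps)
      then show ?thesis using \<open>h > 0\<close> by (simp add: L_def mult.assoc)
    qed
    have kernel: "complex_of_real (vp_prod N L (c v) x) =
        (\<Sum>J\<in>E. of_real (a J) *
          (cis (- (2 * pi * (\<Sum>i\<in>UNIV. k J i * v i) / m)) * e J x))" for v x
      unfolding phase[symmetric] unfolding a_def e_def E_def k_def
      by (rule vp_prod_fourier_series)
    have series: "complex_of_real (\<Sum>v\<in>V. w v * (f x * vp_prod N L (c v) x)) =
        (\<Sum>J\<in>E. of_real (a J) * W J * (complex_of_real (f x) * e J x))" for x
    proof -
      have "complex_of_real (\<Sum>v\<in>V. w v * (f x * vp_prod N L (c v) x)) =
          (\<Sum>v\<in>V. \<Sum>J\<in>E. of_real (a J) *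
            (of_real (w v) * cis (- (2 * pi * (\<Sum>i\<in>UNIV. k J i * v i) / m))) *
            (complex_of_real (f x) * e J x))"
        by (simp add: kernel sum_distrib_left mult_ac)
      also have "\<dots> = (\<Sum>J\<in>E. of_real (a J) * W J * (complex_of_real (f x) * e J x))"
        by (subst sum.swap) (simp add: W_def sum_distrib_left sum_distrib_right)
      finally show ?thesis .
    qed
    have "complex_of_real (\<Sum>v\<in>V. w v * (LINT x|lborel. f x * vp_prod N L (c v) x)) =
        complex_of_real (LINT x|lborel. (\<Sum>v\<in>V. w v * (f x * vp_prod N L (c v) x)))"
      using integrable_vp_prod[OF int \<open>L > 0\<close>]
      by (subst Bochner_Integration.integral_sum) simp_all
    also have "\<dots> = (LINT x|lborel. (\<Sum>J\<in>E. of_real (a J) * W J * (complex_of_real (f x) * e J x)))"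
      by (simp only: integral_complex_of_real[symmetric] series)
    also have "\<dots> = (\<Sum>J\<in>E. of_real (a J) * W J * fourier f (\<chi> i. - k J i / L))"
      unfolding fourier_pairing e_def[symmetric]
      by (subst Bochner_Integration.integral_sum) (simp_all add: int_e)
    finally have spectral: "complex_of_real (\<Sum>v\<in>V. w v * (LINT x|lborel. f x * vp_prod N L (c v) x)) =
        (\<Sum>J\<in>E. of_real (a J) * W J * fourier f (\<chi> i. - k J i / L))" .
    have "0 \<le> a J" for J
      unfolding a_def by (intro prod_nonneg vp_coeff_nonneg ballI)
    then have a_nonneg: "0 \<le> complex_of_real (a J)" for J
      by (simp add: less_eq_complex_def)
    have W_nonneg: "0 \<le> W J" for J
      unfolding W_def by (rule dual)
    have "of_real (\<Sum>v\<in>V. w v) * 1 \<le> of_real (\<Sum>v\<in>V. w v) * fourier f 0"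
      by (intro mult_left_mono fourier_0) (auto simp: less_eq_complex_def sum_nonneg V)
    also have "\<dots> = of_real (a J0) * W J0 * fourier f (\<chi> i. - k J0 i / L)"
      by (simp add: a_def W_def k_def J0_def zero_vec_def)
    also have "\<dots> \<le> (\<Sum>J\<in>E. of_real (a J) * W J * fourier f (\<chi> i. - k J i / L))"
      by (intro member_le_sum \<open>J0 \<in> E\<close> \<open>finite E\<close> mult_nonneg_nonneg a_nonneg W_nonneg fourier_nonneg)
    finally show ?thesis
      unfolding spectral[symmetric] by (simp add: less_eq_complex_def)
  qed

  have outside: "f x \<le> 0" if "x \<notin> cell L" for x
  proof -
    have "\<exists>i. \<not> (- L / 2 \<le> x $ i \<and> x $ i \<le> L / 2)"
      using that unfolding mem_box_cart vec_lambda_beta by blast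
    then obtain i where "\<not> (- L / 2 \<le> x $ i \<and> x $ i \<le> L / 2)" ..
    then have "r \<le> \<bar>x $ i\<bar>" using cell unfolding L_def[symmetric] by linarith
    then show ?thesis using sign component_le_norm_cart[of x i] by force
  qed
  have lattice: "f p \<le> b v"
    if v: "v \<in> V" "w v \<noteq> 0" and p: "\<And>i. \<exists>z::int. p $ i = c v $ i + L * z" for p v
  proof -
    obtain z where z: "\<And>i. p $ i = c v $ i + L * of_int (z i)" using p by metis
    define u where "u i = v i + int m * z i" for i
    have p_u: "p = h *\<^sub>R (\<chi> i. real_of_int (u i))"
      by (simp add: vec_eq_iff z c_def u_def L_def algebra_simps)
    show ?thesis
    proof (cases "u = (\<lambda>_. 0)")
      case True
      then have "int m dvd v i" for i
        by (metis add.commute add_left_cancel dvd_add_left_iff dvd_triv_left dvd_0_right u_def)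
      then show ?thesis using True p_u by (simp add: b_def zero_vec_def[symmetric])
    next
      case False
      have "r \<le> h * norm (\<chi> i. real_of_int (u i))"
        by (rule far[OF v _ False]) (simp add: u_def)
      then have "f p \<le> 0" using \<open>h > 0\<close> by (intro sign) (simp add: p_u)
      with f_0 show ?thesis by (simp add: b_def)
    qed
  qed

  have approx: "(\<Sum>v\<in>V. w v) \<le> (\<Sum>v\<in>V. w v * (L ^ CARD('n) * (b v + \<epsilon>)))" if "\<epsilon> > 0" for \<epsilon>
  proof -
    have "\<exists>X::real. \<forall>N. w v * (LINT x|lborel. f x * vp_prod N L (c v) x) \<le>
        w v * (L ^ CARD('n) * (b v + \<epsilon>) + X / real (2 * N + 2))" if "v \<in> V" for v
    proof (cases "w v = 0")
      case False
      obtain X :: real where X: "\<And>N. (LINT x|lborel. f x * vp_prod N L (c v) x) \<le>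
          L ^ CARD('n) * (b v + \<epsilon>) + X / real (2 * N + 2)"
        using vp_prod_upper_bound[OF cont int \<open>L > 0\<close> \<open>\<epsilon> > 0\<close> outside lattice[OF \<open>v \<in> V\<close> False]]
        by meson
      show ?thesis
        by (intro exI[of _ X] allI mult_left_mono X V(2) \<open>v \<in> V\<close>)
    qed auto
    then obtain X :: "('n \<Rightarrow> int) \<Rightarrow> real" where X: "\<And>v N. v \<in> V \<Longrightarrow> w v * (LINT x|lborel. f x * vp_prod N L (c v) x) \<le>
        w v * (L ^ CARD('n) * (b v + \<epsilon>) + X v / real (2 * N + 2))"
      by metis
    have "(\<Sum>v\<in>V. w v) \<le> (\<Sum>v\<in>V. w v * (L ^ CARD('n) * (b v + \<epsilon>) + X v / real (2 * N + 2)))" for N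
      by (rule order_trans[OF lower[of N] sum_mono[OF X]])
    moreover have "filterlim (\<lambda>N. real (2 * N + 2)) at_top sequentially"
      by (intro filterlim_compose[OF filterlim_real_sequentially] filterlim_subseq)
         (auto simp: strict_mono_def)
    then have "(\<lambda>N. \<Sum>v\<in>V. w v * (L ^ CARD('n) * (b v + \<epsilon>) + X v / real (2 * N + 2)))
        \<longlonglongrightarrow> (\<Sum>v\<in>V. w v * (L ^ CARD('n) * (b v + \<epsilon>) + 0))"
      by (intro tendsto_intros real_tendsto_divide_at_top[OF tendsto_const])
    ultimately show ?thesis
      by (intro LIMSEQ_le_const[of _ _ "\<Sum>v\<in>V. w v"]) auto
  qed
  have "(\<Sum>v\<in>V. w v) \<le> (\<Sum>v\<in>V. w v * (L ^ CARD('n) * b v))"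
  proof (rule tendsto_lowerbound)
    show "((\<lambda>\<epsilon>. \<Sum>v\<in>V. w v * (L ^ CARD('n) * (b v + \<epsilon>))) \<longlongrightarrow> (\<Sum>v\<in>V. w v * (L ^ CARD('n) * b v)))
        (at_right 0)"
      by (rule tendsto_eq_intros refl | simp)+
    show "\<forall>\<^sub>F \<epsilon> in at_right 0. (\<Sum>v\<in>V. w v) \<le> (\<Sum>v\<in>V. w v * (L ^ CARD('n) * (b v + \<epsilon>)))"
      using approx by (auto simp: eventually_at_filter)
  qed simp
  also have "\<dots> = L ^ CARD('n) * (\<Sum>v\<in>{v\<in>V. \<forall>i. int m dvd v i}. w v) * f 0"
    using V(1) by (simp add: b_def sum_distrib_left sum_distrib_right sum.inter_filter mult_ac if_distrib cong: if_cong)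
  finally show ?thesis by (simp add: L_def)
qed

section \<open>Exact arithmetic with the square root of two\<close>

text \<open>\<open>Zs a b\<close> stands for \<open>a + b \<surd>2\<close>.\<close>
datatype zsqrt2 = Zs int int

instantiation zsqrt2 :: "{plus, times}"
begin
fun plus_zsqrt2 where "Zs a b + Zs c d = Zs (a + c) (b + d)"
fun times_zsqrt2 where "Zs a b * Zs c d = Zs (a * c + 2 * (b * d)) (a * d + b * c)"
instance ..
end

fun val :: "zsqrt2 \<Rightarrow> real" where "val (Zs a b) = a + b * sqrt 2"

lemma val_plus [simp]: "val (x + y) = val x + val y"
  by (cases x; cases y) (simp add: algebra_simps)

lemma val_times [simp]: "val (x * y) = val x * val y"
  by (cases x; cases y) (simp add: algebra_simps)

text \<open>
  This says that both \<open>a + b \<surd>2\<close> and its conjugate \<open>a - b \<surd>2\<close> are nonnegative, which is simpler to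
  test than the sign of one of them. Nothing is lost: conjugation exchanges the values of the
  transform at the frequencies \<open>k\<close> and \<open>3k\<close>, and both have to be nonnegative.
\<close>
fun zsqrt2_nonneg :: "zsqrt2 \<Rightarrow> bool" where
  "zsqrt2_nonneg (Zs a b) \<longleftrightarrow> 0 \<le> a \<and> 2 * (b * b) \<le> a * a"

lemma val_nonneg: "zsqrt2_nonneg z \<Longrightarrow> 0 \<le> val z"
proof (cases z)
  case (Zs a b)
  assume "zsqrt2_nonneg z"
  then have a: "0 \<le> a" and "2 * (b * b) \<le> a * a" by (simp_all add: Zs)
  then have "real_of_int (2 * (b * b)) \<le> real_of_int (a * a)" by (simp only: of_int_le_iff)
  then have "(real_of_int b * sqrt 2)\<^sup>2 \<le> (real_of_int a)\<^sup>2"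
    by (simp add: power_mult_distrib power2_eq_square mult_ac)
  then have "\<bar>real_of_int b * sqrt 2\<bar> \<le> real_of_int a"
    using a by (metis abs_le_square_iff abs_of_nonneg of_int_0_le_iff)
  then show ?thesis by (simp add: Zs)
qed

section \<open>Arrays indexed by counts\<close>

text \<open>
  An array of dimension \<open>d\<close> and size \<open>n\<close> has one entry for each list \<open>c\<close> of \<open>d\<close> natural numbers with sum
  at most \<open>n\<close> (predicate \<open>shape\<close>). \<open>Slice s ss\<close> consists of the entries with first index 0, an array
  \<open>s\<close> of dimension \<open>d - 1\<close>, and of the remaining entries \<open>ss\<close>, with the first index lowered by 1. The
  index counts how many of \<open>n\<close> coordinates fall in each of the first \<open>d\<close> of \<open>d + 1\<close> classes; the
  count of the last class is what is missing from \<open>n\<close>.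
\<close>
datatype 'a arr = Leaf 'a | Empty | Slice "'a arr" "'a arr"

fun entry :: "'a arr \<Rightarrow> nat list \<Rightarrow> 'a" where
  "entry (Leaf x) c = x"
| "entry (Slice s ss) (0 # c) = entry s c"
| "entry (Slice s ss) (Suc a # c) = entry ss (a # c)"

fun shape :: "nat \<Rightarrow> nat \<Rightarrow> 'a arr \<Rightarrow> bool" where
  "shape 0 n t \<longleftrightarrow> (\<exists>x. t = Leaf x)"
| "shape (Suc d) 0 t \<longleftrightarrow> (\<exists>s. t = Slice s Empty \<and> shape d 0 s)"
| "shape (Suc d) (Suc n) t \<longleftrightarrow> (\<exists>s ss. t = Slice s ss \<and> shape d (Suc n) s \<and> shape (Suc d) n ss)"

fun add_scaled :: "'a::{plus,times} \<Rightarrow> 'a arr \<Rightarrow> 'a arr \<Rightarrow> 'a arr" where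
  "add_scaled w (Leaf x) (Leaf y) = Leaf (x + w * y)"
| "add_scaled w (Slice s ss) (Slice t ts) = Slice (add_scaled w s t) (add_scaled w ss ts)"
| "add_scaled w _ _ = Empty"

text \<open>
  Sums out one coordinate: the coordinate may lie in any class \<open>j\<close>, with weight \<open>ws ! j\<close>, and then
  raises the \<open>j\<close>-th count by one. For the last class no explicit count changes, and this is
  the case of \<open>Leaf\<close>. The size of the array drops by one, so the slice with the largest first index
  is used only as the raised neighbour of the one before it.
\<close>
fun contract :: "'a::{plus,times} list \<Rightarrow> 'a arr \<Rightarrow> 'a arr" where
  "contract (w # ws) (Leaf x) = Leaf (w * x)"
| "contract (w # ws) (Slice s (Slice t ts)) =
     Slice (add_scaled w (contract ws s) t) (contract (w # ws) (Slice t ts))"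
| "contract _ _ = Empty"

text \<open>The effect of \<open>contract\<close> on entries, as an operator on functions of the counts.\<close>
fun shift_sum :: "real list \<Rightarrow> (nat list \<Rightarrow> real) \<Rightarrow> nat list \<Rightarrow> real" where
  "shift_sum (w # ws) u [] = w * u []"
| "shift_sum (w # ws) u (a # c) = w * u (Suc a # c) + shift_sum ws (\<lambda>c. u (a # c)) c"
| "shift_sum [] u c = 0"

lemma shape_add_scaled: "shape d n s \<Longrightarrow> shape d n t \<Longrightarrow> shape d n (add_scaled w s t)"
  by (induction d n s arbitrary: t rule: shape.induct) auto

lemma entry_add_scaled:
  assumes "shape d n s" "shape d n t" "length c = d" "sum_list c \<le> n"
  shows "entry (add_scaled w s t) c = entry s c + w * entry t c"
  using assms
proof (induction d n s arbitrary: t c rule: shape.induct)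
  case (1 n s)
  then show ?case by auto
next
  case (2 d s)
  then obtain c' where "c = 0 # c'" by (cases c) auto
  with 2 show ?case by auto
next
  case (3 d n s)
  then obtain a c' where c: "c = a # c'" by (cases c) auto
  with 3 show ?case by (cases a) auto
qed

lemma shape_contract: "shape d (Suc n) t \<Longrightarrow> length ws = Suc d \<Longrightarrow> shape d n (contract ws t)"
proof (induction d n t arbitrary: ws rule: shape.induct)
  case (1 n t)
  then show ?case by (cases ws) auto
next
  case (2 d t)
  then obtain w ws' where "ws = w # ws'" by (cases ws) auto
  with 2 show ?case by (auto intro!: shape_add_scaled)
next
  case (3 d n t)
  then obtain w ws' where "ws = w # ws'" by (cases ws) auto
  with 3 show ?case by (auto intro!: shape_add_scaled)
qed

lemma entry_contract:
  assumes "shape d (Suc n) t" "length ws = Suc d" "length c = d" "sum_list c \<le> n"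
  shows "val (entry (contract ws t) c) = shift_sum (map val ws) (\<lambda>c. val (entry t c)) c"
  using assms
proof (induction d n t arbitrary: ws c rule: shape.induct)
  case (1 n t)
  then show ?case by (cases ws) auto
next
  case (2 d t)
  then obtain w ws' where ws: "ws = w # ws'" by (cases ws) auto
  from 2 obtain c' where c: "c = 0 # c'" by (cases c) auto
  from 2 ws c show ?case
    by (auto simp: entry_add_scaled[OF shape_contract[of d 0]])
next
  case (3 d n t)
  then obtain w ws' where ws: "ws = w # ws'" by (cases ws) auto
  from 3 obtain a c' where c: "c = a # c'" by (cases c) auto
  from 3 ws c show ?case
    by (cases a) (auto simp: entry_add_scaled[OF shape_contract[of d "Suc n"]])
qed

fun slice_0 :: "(nat list \<times> 'a) list \<Rightarrow> (nat list \<times> 'a) list" where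
  "slice_0 ((0 # c, w) # ps) = (c, w) # slice_0 ps"
| "slice_0 (p # ps) = slice_0 ps"
| "slice_0 [] = []"

fun slice_Suc :: "(nat list \<times> 'a) list \<Rightarrow> (nat list \<times> 'a) list" where
  "slice_Suc ((Suc a # c, w) # ps) = (a # c, w) # slice_Suc ps"
| "slice_Suc (p # ps) = slice_Suc ps"
| "slice_Suc [] = []"

text \<open>A table lists only the nonzero entries of an array.\<close>
definition lookup :: "(nat list \<times> int) list \<Rightarrow> nat list \<Rightarrow> int" where
  "lookup ps c = (case map_of ps c of None \<Rightarrow> 0 | Some w \<Rightarrow> w)"

lemma lookup_slice_0: "lookup (slice_0 ps) c = lookup ps (0 # c)"
  unfolding lookup_def by (induction ps rule: slice_0.induct) auto

lemma lookup_slice_Suc: "lookup (slice_Suc ps) (a # c) = lookup ps (Suc a # c)"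
  unfolding lookup_def by (induction ps rule: slice_Suc.induct) auto

fun tabulate :: "nat \<Rightarrow> nat \<Rightarrow> (nat list \<times> int) list \<Rightarrow> zsqrt2 arr" where
  "tabulate 0 n ps = Leaf (Zs (case ps of [] \<Rightarrow> 0 | p # _ \<Rightarrow> snd p) 0)"
| "tabulate (Suc d) 0 ps = Slice (tabulate d 0 (slice_0 ps)) Empty"
| "tabulate (Suc d) (Suc n) ps =
     Slice (tabulate d (Suc n) (slice_0 ps)) (tabulate (Suc d) n (slice_Suc ps))"

lemma shape_tabulate: "shape d n (tabulate d n ps)"
  by (induction d n ps rule: tabulate.induct) auto

lemma length_slice_0:
  "\<forall>(c, w)\<in>set ps. length c = Suc d \<Longrightarrow> \<forall>(c, w)\<in>set (slice_0 ps). length c = d"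
  by (induction ps rule: slice_0.induct) auto

lemma length_slice_Suc:
  "\<forall>(c, w)\<in>set ps. length c = Suc d \<Longrightarrow> \<forall>(c, w)\<in>set (slice_Suc ps). length c = Suc d"
  by (induction ps rule: slice_Suc.induct) auto

lemma entry_tabulate:
  assumes "\<forall>(c, w)\<in>set ps. length c = d" "length c = d" "sum_list c \<le> n"
  shows "entry (tabulate d n ps) c = Zs (lookup ps c) 0"
  using assms
proof (induction d n ps arbitrary: c rule: tabulate.induct)
  case (1 n ps)
  then show ?case by (cases ps) (auto simp: lookup_def)
next
  case (2 d ps)
  then obtain c' where "c = 0 # c'" by (cases c) auto
  with 2 length_slice_0[OF 2(2)] show ?case by (auto simp: lookup_slice_0)
next
  case (3 d n ps)
  then obtain a c' where c: "c = a # c'" by (cases c) auto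
  with 3 length_slice_0[OF 3(3)] length_slice_Suc[OF 3(3)] show ?case
    by (cases a) (auto simp: lookup_slice_0 lookup_slice_Suc)
qed

section \<open>The discrete Fourier transform of a function of profiles\<close>

text \<open>
  Entry \<open>j\<close> of \<open>class_chars q\<close> is the sum of the character \<open>exp(2\<pi>iqx/8)\<close> over the residues \<open>x\<close> modulo 8
  with absolute value \<open>j\<close>: \<open>1\<close> for \<open>j = 0\<close>, \<open>2 cos (\<pi>qj/4)\<close> for \<open>j = 1, 2, 3\<close>, and \<open>cos (\<pi>q)\<close> for
  \<open>j = 4\<close>, a class with only one residue.
\<close>
definition class_chars :: "nat \<Rightarrow> zsqrt2 list" where
  "class_chars q =
    (if q = 0 then [Zs 1 0, Zs 2 0, Zs 2 0, Zs 2 0, Zs 1 0]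
     else if q = 1 then [Zs 1 0, Zs 0 1, Zs 0 0, Zs 0 (-1), Zs (-1) 0]
     else if q = 2 then [Zs 1 0, Zs 0 0, Zs (-2) 0, Zs 0 0, Zs 1 0]
     else if q = 3 then [Zs 1 0, Zs 0 (-1), Zs 0 0, Zs 0 1, Zs (-1) 0]
     else [Zs 1 0, Zs (-2) 0, Zs 2 0, Zs (-2) 0, Zs 1 0])"

text \<open>
  The transform is symmetric in the coordinates of the frequency, so nondecreasing frequencies
  suffice. Going through them as a tree shares the contractions along common prefixes: \<open>js\<close> lists
  the values that the remaining coordinates may take, and the two recursive calls skip the least
  of them or use it once more.
\<close>
fun dual_check :: "nat \<Rightarrow> nat list \<Rightarrow> zsqrt2 arr \<Rightarrow> bool" where
  "dual_check 0 js t \<longleftrightarrow> zsqrt2_nonneg (entry t [0, 0, 0, 0])"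
| "dual_check (Suc n) [] t \<longleftrightarrow> True"
| "dual_check (Suc n) (j # js) t \<longleftrightarrow>
     dual_check (Suc n) js t \<and> dual_check n (j # js) (contract (class_chars j) t)"

lemma length_class_chars [simp]: "length (class_chars q) = 5"
  by (simp add: class_chars_def)

lemma dual_check_sound:
  assumes "dual_check n js t" "sorted_wrt (<) js" "sorted qs" "set qs \<subseteq> set js" "length qs = n"
  shows "zsqrt2_nonneg (entry (fold (\<lambda>q. contract (class_chars q)) qs t) [0, 0, 0, 0])"
  using assms
proof (induction n js t arbitrary: qs rule: dual_check.induct)
  case (3 n j js t)
  then obtain q qs' where qs: "qs = q # qs'" by (cases qs) auto
  show ?case
  proof (cases "q = j")
    case True
    then show ?thesis using 3 qs by auto
  next
    case False
    then have "j < q" using 3 qs by auto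
    then have "j \<notin> set qs" using 3(5) qs by force
    then have "set qs \<subseteq> set js" using 3 by auto
    then show ?thesis using 3 by auto
  qed
qed auto

text \<open>
  The discrete Fourier transform of a function of profiles, one coordinate at a time. The list
  consists of the classes of the coordinates of the frequency.
\<close>
fun transform :: "nat list \<Rightarrow> (nat list \<Rightarrow> real) \<Rightarrow> real" where
  "transform [] u = u [0, 0, 0, 0]"
| "transform (q # qs) u = transform qs (shift_sum (map val (class_chars q)) u)"

lemma list_4_cases:
  assumes "length c = 4"
  obtains a0 a1 a2 a3 where "c = [a0, a1, a2, a3]"
  using assms by (auto simp: numeral_eq_Suc length_Suc_conv)

lemma list_5_cases:
  assumes "length c = 5"
  obtains a0 a1 a2 a3 a4 where "c = [a0, a1, a2, a3, a4]"
  using assms by (auto simp: numeral_eq_Suc length_Suc_conv)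

lemma transform_cong:
  assumes "\<And>c. length c = 4 \<Longrightarrow> sum_list c \<le> length qs \<Longrightarrow> u c = u' c"
  shows "transform qs u = transform qs u'"
  using assms
proof (induction qs arbitrary: u u')
  case Nil
  show ?case using Nil[of "[0,0,0,0]"] by simp
next
  case (Cons q qs)
  show ?case
    unfolding transform.simps
  proof (rule Cons.IH)
    fix c :: "nat list"
    assume c: "length c = 4" "sum_list c \<le> length qs"
    obtain a0 a1 a2 a3 where c': "c = [a0, a1, a2, a3]" using c(1) by (rule list_4_cases)
    obtain w0 w1 w2 w3 w4 where w: "class_chars q = [w0, w1, w2, w3, w4]"
      using length_class_chars by (rule list_5_cases)
    show "shift_sum (map val (class_chars q)) u c = shift_sum (map val (class_chars q)) u' c"
      using c(2) by (simp add: c' w Cons.prems)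
  qed
qed

lemma transform_contract:
  assumes "shape 4 (length qs) t"
  shows "transform qs (\<lambda>c. val (entry t c)) =
    val (entry (fold (\<lambda>q. contract (class_chars q)) qs t) [0, 0, 0, 0])"
  using assms
proof (induction qs arbitrary: t)
  case (Cons q qs)
  have "transform (q # qs) (\<lambda>c. val (entry t c)) = transform qs (\<lambda>c. val (entry (contract (class_chars q) t) c))"
    unfolding transform.simps using Cons.prems
    by (intro transform_cong entry_contract[symmetric]) auto
  also have "\<dots> = val (entry (fold (\<lambda>q. contract (class_chars q)) qs (contract (class_chars q) t)) [0, 0, 0, 0])"
    using Cons.prems by (intro Cons.IH shape_contract) auto
  finally show ?case by simp
qed simp

text \<open>
  For values in \<open>{-3..4}\<close>, the number of indices with absolute value 4 is determined by these
  counts.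
\<close>
definition profile :: "'n set \<Rightarrow> ('n \<Rightarrow> int) \<Rightarrow> nat list" where
  "profile A v = map (\<lambda>j. card {i \<in> A. \<bar>v i\<bar> = int j}) [0, 1, 2, 3]"

definition bump :: "nat \<Rightarrow> nat list \<Rightarrow> nat list" where
  "bump j c = (if j < length c then c[j := Suc (c ! j)] else c)"

lemma profile_insert:
  assumes "finite A" "i \<notin> A"
  shows "profile (insert i A) (v(i := x)) = bump (nat \<bar>x\<bar>) (profile A v)"
proof -
  have *: "{i' \<in> insert i A. \<bar>(v(i := x)) i'\<bar> = int j} =
      (if \<bar>x\<bar> = int j then insert i {i' \<in> A. \<bar>v i'\<bar> = int j} else {i' \<in> A. \<bar>v i'\<bar> = int j})" for j
    using assms(2) by auto
  have **: "card {i' \<in> insert i A. \<bar>(v(i := x)) i'\<bar> = int j} =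
      card {i' \<in> A. \<bar>v i'\<bar> = int j} + (if nat \<bar>x\<bar> = j then 1 else 0)" for j
    unfolding * using assms by auto
  consider "nat \<bar>x\<bar> = 0" | "nat \<bar>x\<bar> = 1" | "nat \<bar>x\<bar> = 2" | "nat \<bar>x\<bar> = 3" | "nat \<bar>x\<bar> > 3"
    by linarith
  then show ?thesis
    unfolding profile_def ** by cases (simp_all add: bump_def)
qed

text \<open>The distance from \<open>k\<close> to the nearest multiple of 8.\<close>
definition dual_class :: "int \<Rightarrow> nat" where
  "dual_class k = nat (min (k mod 8) (8 - k mod 8))"

lemma dual_class_mem: "dual_class k \<in> set [0, 1, 2, 3, 4]"
proof -
  have "dual_class k \<le> 4" unfolding dual_class_def by linarith
  then show ?thesis by auto
qed

lemma cos_dual_class: "cos (pi * k / 4) = cos (pi * dual_class k / 4)"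
proof -
  define d where "d = dual_class k"
  define q where "q = (if k mod 8 \<le> 4 then k div 8 else k div 8 + 1)"
  have "k = 8 * q + int d \<or> k = 8 * q - int d"
  proof (cases "k mod 8 \<le> 4")
    case True
    then have "int d = k mod 8" by (simp add: d_def dual_class_def)
    with True show ?thesis by (simp add: q_def)
  next
    case False
    then have "int d = 8 - k mod 8" by (simp add: d_def dual_class_def)
    with False show ?thesis
      using mult_div_mod_eq[of 8 k] by (simp add: q_def)
  qed
  then have "cos (pi * k / 4) = cos (pi * d / 4)"
  proof
    assume "k = 8 * q + int d"
    then have k: "pi * k / 4 = pi * d / 4 + 2 * pi * q" by (simp add: field_simps)
    show ?thesis unfolding k cos_add by simp
  next
    assume "k = 8 * q - int d"
    then have "real_of_int k = 8 * q - d" by simp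
    then have k: "pi * k / 4 = 2 * pi * q - pi * d / 4"
      by (simp add: right_diff_distrib diff_divide_distrib)
    show ?thesis unfolding k cos_diff by simp
  qed
  then show ?thesis by (simp only: d_def)
qed

text \<open>
  The residues \<open>x\<close> and \<open>-x\<close> affect the profile in the same way, so only \<open>cos (j \<theta>)\<close> with
  \<open>\<theta> = \<pi>k/4\<close> occurs, a polynomial in \<open>cos \<theta>\<close>; and \<open>cos \<theta>\<close> depends only on the class of \<open>k\<close>.
\<close>
lemma character_sum:
  assumes "length c = 4"
  shows "(\<Sum>x\<in>{-3..4::int}. of_real (u (bump (nat \<bar>x\<bar>) c)) * cis (- (2 * pi * (k * x) / 8))) =
    complex_of_real (shift_sum (map val (class_chars (dual_class k))) u c)"
proof -
  obtain a0 a1 a2 a3 where c: "c = [a0, a1, a2, a3]" using assms by (rule list_4_cases)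
  define \<theta> where "\<theta> = pi * k / 4"
  define C where "C = cos \<theta>"
  have cos2: "cos (2 * \<theta>) = 2 * C\<^sup>2 - 1" unfolding C_def by (rule cos_double_cos)
  have cos3: "cos (3 * \<theta>) = 4 * C ^ 3 - 3 * C" unfolding C_def by (rule cos_treble_cos)
  have cos4: "cos (4 * \<theta>) = 2 * (2 * C\<^sup>2 - 1)\<^sup>2 - 1"
    using cos_double_cos[of "2 * \<theta>"] by (simp add: cos2)
  have sin4: "sin (4 * \<theta>) = 0" by (simp add: \<theta>_def sin_zero_iff_int2)
  have pair: "cis a + cis (- a) = of_real (2 * cos a)" for a by (simp add: complex_eq_iff)
  have "{-3..4::int} = {0, 1, -1, 2, -2, 3, -3, 4}" by auto
  then have "(\<Sum>x\<in>{-3..4::int}. of_real (u (bump (nat \<bar>x\<bar>) c)) * cis (- (2 * pi * (k * x) / 8))) =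
      of_real (u (bump 0 c)) + of_real (u (bump 1 c)) * (cis \<theta> + cis (- \<theta>))
      + of_real (u (bump 2 c)) * (cis (2 * \<theta>) + cis (- (2 * \<theta>)))
      + of_real (u (bump 3 c)) * (cis (3 * \<theta>) + cis (- (3 * \<theta>)))
      + of_real (u (bump 4 c)) * cis (- (4 * \<theta>))"
    by (simp add: \<theta>_def algebra_simps)
  also have "cis (- (4 * \<theta>)) = of_real (cos (4 * \<theta>))"
    using sin4 by (simp add: complex_eq_iff)
  finally have sum: "(\<Sum>x\<in>{-3..4::int}. of_real (u (bump (nat \<bar>x\<bar>) c)) * cis (- (2 * pi * (k * x) / 8))) =
      complex_of_real (u (bump 0 c) + u (bump 1 c) * (2 * C) + u (bump 2 c) * (2 * (2 * C\<^sup>2 - 1))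
      + u (bump 3 c) * (2 * (4 * C ^ 3 - 3 * C)) + u (bump 4 c) * (2 * (2 * C\<^sup>2 - 1)\<^sup>2 - 1))"
    unfolding pair cos2 cos3 cos4 by (simp add: C_def)
  have C: "C = cos (pi * dual_class k / 4)"
    unfolding C_def \<theta>_def by (rule cos_dual_class)
  have "dual_class k \<in> {0, 1, 2, 3, 4}" using dual_class_mem[of k] by simp
  moreover have "cos (pi * 3 / 4) = - (sqrt 2 / 2)"
    using cos_pi_minus[of "pi / 4"] by (simp add: cos_45 field_simps)
  ultimately consider "dual_class k = 0" "C = 1" | "dual_class k = 1" "C = sqrt 2 / 2" | "dual_class k = 2" "C = 0"
    | "dual_class k = 3" "C = - (sqrt 2 / 2)" | "dual_class k = 4" "C = - 1"
    using C by (auto simp: cos_45)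
  then have "map val (class_chars (dual_class k)) =
      [1, 2 * C, 2 * (2 * C\<^sup>2 - 1), 2 * (4 * C ^ 3 - 3 * C), 2 * (2 * C\<^sup>2 - 1)\<^sup>2 - 1]"
    by cases (simp_all (no_asm_simp) add: class_chars_def power2_eq_square power3_eq_cube)
  then show ?thesis
    unfolding sum by (simp add: c bump_def mult.commute)
qed

text \<open>
  The coordinates may be summed out in any order. The list \<open>xs\<close> records this order, which is
  free to depend on the frequency \<open>k\<close>.
\<close>
lemma weighted_character_sum:
  assumes "distinct xs"
  shows "(\<Sum>v\<in>PiE (set xs) (\<lambda>_. {-3..4}). of_real (u (profile (set xs) v)) *
      cis (- (2 * pi * (\<Sum>i\<in>set xs. k i * v i) / 8))) =
    complex_of_real (transform (map (\<lambda>i. dual_class (k i)) xs) u)"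
  using assms
proof (induction xs arbitrary: u)
  case Nil
  show ?case by (simp add: profile_def)
next
  case (Cons i xs)
  define A where "A = set xs"
  have A: "finite A" "i \<notin> A" using Cons.prems by (auto simp: A_def)
  define R where "R = {-3..4::int}"
  define P where "P = PiE A (\<lambda>_. R)"
  have inj: "inj_on (\<lambda>(x, g). g(i := x)) (R \<times> P)"
    unfolding P_def by (rule inj_combinator[OF A(2)])
  have "(\<Sum>v\<in>PiE (insert i A) (\<lambda>_. R). of_real (u (profile (insert i A) v)) *
      cis (- (2 * pi * (\<Sum>i'\<in>insert i A. k i' * v i') / 8))) =
     (\<Sum>(x, v)\<in>R \<times> P. of_real (u (bump (nat \<bar>x\<bar>) (profile A v))) *
      (cis (- (2 * pi * (k i * x) / 8)) * cis (- (2 * pi * (\<Sum>i'\<in>A. k i' * v i') / 8))))"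
    unfolding PiE_insert_eq P_def[symmetric] sum.reindex[OF inj] comp_def
  proof (intro sum.cong refl, clarify)
    fix x v
    have "(\<Sum>i'\<in>A. k i' * (v(i := x)) i') = (\<Sum>i'\<in>A. k i' * v i')"
      using A(2) by (intro sum.cong) auto
    then have "- (2 * pi * (\<Sum>i'\<in>insert i A. k i' * (v(i := x)) i') / 8) =
        - (2 * pi * (k i * x) / 8) + - (2 * pi * (\<Sum>i'\<in>A. k i' * v i') / 8)"
      using A by (simp add: sum.insert field_simps del: of_int_sum fun_upd_apply) simp
    then show "of_real (u (profile (insert i A) (v(i := x)))) *
          cis (- (2 * pi * (\<Sum>i'\<in>insert i A. k i' * (v(i := x)) i') / 8)) =
        of_real (u (bump (nat \<bar>x\<bar>) (profile A v))) *
          (cis (- (2 * pi * (k i * x) / 8)) * cis (- (2 * pi * (\<Sum>i'\<in>A. k i' * v i') / 8)))"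
      by (simp only: profile_insert[OF A] cis_mult)
  qed
  also have "\<dots> = (\<Sum>v\<in>P. (\<Sum>x\<in>R. of_real (u (bump (nat \<bar>x\<bar>) (profile A v))) * cis (- (2 * pi * (k i * x) / 8))) *
      cis (- (2 * pi * (\<Sum>i'\<in>A. k i' * v i') / 8)))"
    unfolding sum.cartesian_product[symmetric] by (subst sum.swap) (simp add: sum_distrib_right mult.assoc)
  also have "\<dots> = (\<Sum>v\<in>P. of_real (shift_sum (map val (class_chars (dual_class (k i)))) u (profile A v)) *
      cis (- (2 * pi * (\<Sum>i'\<in>A. k i' * v i') / 8)))"
    unfolding R_def by (subst character_sum) (simp_all add: profile_def)
  also have "\<dots> = complex_of_real (transform (map (\<lambda>i. dual_class (k i)) (i # xs)) u)"
    using Cons.IH[of "shift_sum (map val (class_chars (dual_class (k i)))) u"] Cons.prems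
    by (simp add: P_def A_def R_def)
  finally show ?case by (simp add: A_def R_def)
qed

section \<open>The certificate\<close>

text \<open>
  Profiles and their weights, scaled so that the origin, with profile \<open>[7,0,0,0]\<close>, has weight
  \<open>10\<^sup>1\<^sup>1\<close>. In every profile that occurs, the values 1 and 3 together occur an even number of times: the
  measure is supported on vectors with even coordinate sum.
\<close>
definition weight_table :: "(nat list \<times> int) list" where
  "weight_table =
  [([7,0,0,0], 100000000000),
   ([6,0,0,0], 8437378889),
   ([5,0,0,2], 3497587619),
   ([5,0,0,0], 8600882527),
   ([4,1,0,1], 272515828),
   ([4,0,2,0], 207260410),
   ([4,0,0,2], 296128856),
   ([4,0,0,0], 9058348600),
   ([3,1,1,1], 57942262),
   ([3,1,0,3], 165171033),
   ([3,0,4,0], 3301379858),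
   ([3,0,2,0], 1337021336),
   ([3,0,0,4], 216966698),
   ([3,0,0,0], 6732422029),
   ([2,3,1,1], 533929611),
   ([2,2,0,2], 124471551),
   ([2,1,2,1], 182856108),
   ([2,1,1,3], 323878205),
   ([2,0,4,0], 2101778212),
   ([2,0,3,2], 10128315),
   ([2,0,3,0], 641776847),
   ([2,0,1,2], 85914565),
   ([2,0,1,0], 1083953817),
   ([2,0,0,4], 220557979),
   ([2,0,0,2], 72494772),
   ([1,3,1,1], 244001482),
   ([1,3,0,3], 81020690),
   ([1,2,3,0], 124692883),
   ([1,2,1,2], 221240379),
   ([1,2,0,0], 425398011),
   ([1,1,3,1], 64149135),
   ([1,1,2,3], 85613223),
   ([1,1,2,1], 13442558),
   ([1,1,1,3], 204334185),
   ([1,1,1,1], 23341810),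
   ([1,1,0,3], 24290941),
   ([1,0,5,0], 468338965),
   ([1,0,4,2], 49192980),
   ([1,0,4,0], 1712998552),
   ([1,0,3,2], 1529386),
   ([1,0,2,4], 31142898),
   ([1,0,2,2], 205180044),
   ([1,0,2,0], 1678695802),
   ([1,0,1,4], 110493631),
   ([1,0,1,0], 335895818),
   ([1,0,0,6], 401259965),
   ([1,0,0,2], 496363072),
   ([1,0,0,0], 1592032386),
   ([0,5,1,1], 17890268),
   ([0,4,3,0], 773863540),
   ([0,4,2,0], 175909516),
   ([0,4,1,2], 69735055),
   ([0,4,1,0], 78655650),
   ([0,4,0,0], 605410146),
   ([0,3,2,1], 79686189),
   ([0,3,1,3], 59535731),
   ([0,3,1,1], 444113),
   ([0,3,0,3], 124400673),
   ([0,2,4,0], 224046087),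
   ([0,2,3,2], 305354234),
   ([0,2,3,0], 72911424),
   ([0,2,1,2], 342520318),
   ([0,2,0,4], 51071343),
   ([0,1,3,3], 108890203),
   ([0,1,3,1], 108034138),
   ([0,1,2,3], 47225491),
   ([0,1,2,1], 112239663),
   ([0,1,1,5], 61886255),
   ([0,1,1,3], 74993119),
   ([0,1,0,5], 78169670),
   ([0,1,0,1], 637199413),
   ([0,0,6,0], 1516483074),
   ([0,0,5,2], 311404857),
   ([0,0,5,0], 388456549),
   ([0,0,4,0], 742122295),
   ([0,0,3,4], 72512800),
   ([0,0,3,2], 104523215),
   ([0,0,3,0], 1121636628),
   ([0,0,2,4], 156171876),
   ([0,0,2,2], 29324253),
   ([0,0,1,6], 182159791),
   ([0,0,1,4], 126935339),
   ([0,0,0,6], 50343342),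
   ([0,0,0,4], 176581489)]"

text \<open>
  A vector of \<open>n\<close> coordinates with absolute value 4 has squared norm \<open>16 n\<close>; a coordinate of absolute
  value \<open>j\<close> lowers this by \<open>16 - j\<^sup>2\<close>. For \<open>n = 7\<close>, squared norm at least 16 means a defect of at
  most \<open>7 \<sdot> 16 - 16 = 96\<close>.
\<close>
definition norm_defect :: "nat list \<Rightarrow> nat" where
  "norm_defect c = sum_list (map2 (*) c [16, 15, 12, 7])"

lemma sum_squares_profile:
  assumes "finite A" "\<And>i. i \<in> A \<Longrightarrow> v i \<in> {-3..4}"
  shows "(\<Sum>i\<in>A. (v i)\<^sup>2) = 16 * int (card A) - int (norm_defect (profile A v))"
proof -
  have "(v i)\<^sup>2 = 16 - (16 * of_bool (\<bar>v i\<bar> = 0) + 15 * of_bool (\<bar>v i\<bar> = 1) +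
      12 * of_bool (\<bar>v i\<bar> = 2) + 7 * of_bool (\<bar>v i\<bar> = 3))" if "i \<in> A" for i
  proof -
    have "v i \<in> {-3, -2, -1, 0, 1, 2, 3, 4}" using assms(2)[OF that] by auto
    then show ?thesis by auto
  qed
  then have "(\<Sum>i\<in>A. (v i)\<^sup>2) = (\<Sum>i\<in>A. 16 - (16 * of_bool (\<bar>v i\<bar> = 0) + 15 * of_bool (\<bar>v i\<bar> = 1) +
      12 * of_bool (\<bar>v i\<bar> = 2) + 7 * of_bool (\<bar>v i\<bar> = 3)))"
    by (rule sum.cong[OF refl])
  also have "\<dots> = 16 * int (card A) - int (norm_defect (profile A v))"
    using assms(1)
    by (simp add: norm_defect_def profile_def sum_subtractf sum.distrib sum_of_bool_eq
        flip: sum_distrib_left Collect_conj_eq)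
       (simp add: Int_def conj_commute)
  finally show ?thesis .
qed

lemma sum_list_profile_le:
  assumes "finite A"
  shows "sum_list (profile A v) \<le> card A"
proof -
  have "sum_list (profile A v) = (\<Sum>i\<in>A. of_bool (\<bar>v i\<bar> = 0) + of_bool (\<bar>v i\<bar> = 1) +
      of_bool (\<bar>v i\<bar> = 2) + of_bool (\<bar>v i\<bar> = 3))"
    using assms by (simp add: profile_def sum.distrib sum_of_bool_eq Int_def)
  also have "\<dots> \<le> (\<Sum>i\<in>A. 1)" by (intro sum_mono) auto
  finally show ?thesis by simp
qed

lemma weight_table_ok:
  "list_all (\<lambda>(c, w). 0 \<le> w \<and> length c = 4 \<and> (c = [7, 0, 0, 0] \<or> norm_defect c \<le> 96)) weight_table"
  by code_simp

lemma weight_table_total: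
  "entry (fold (\<lambda>q. contract (class_chars q)) [0, 0, 0, 0, 0, 0, 0] (tabulate 4 7 weight_table)) [0, 0, 0, 0] =
    Zs 104443824958625 0"
  by code_simp

text \<open>The 330 inequalities of the linear program.\<close>
lemma weight_table_dual: "dual_check 7 [0, 1, 2, 3, 4] (tabulate 4 7 weight_table)"
  by code_simp

definition weight :: "(7 \<Rightarrow> int) \<Rightarrow> int" where
  "weight v = lookup weight_table (profile UNIV v)"

lemma weight_cases:
  obtains "weight v = 0"
  | "0 \<le> weight v" "profile UNIV v = [7, 0, 0, 0] \<or> norm_defect (profile UNIV v) \<le> 96"
proof (cases "map_of weight_table (profile UNIV v)")
  case None
  then show thesis by (intro that(1)) (simp add: weight_def lookup_def)
next
  case (Some w)
  then have "(profile UNIV v, w) \<in> set weight_table" by (rule map_of_SomeD)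
  then show thesis
    using weight_table_ok Some by (intro that(2)) (auto simp: list_all_iff weight_def lookup_def)
qed

lemma weight_nonneg: "0 \<le> weight v"
  by (rule weight_cases[of v]) auto

lemma weight_0: "weight (\<lambda>_. 0) = 10 ^ 11"
proof -
  have "profile UNIV (\<lambda>_ :: 7. 0) = [7, 0, 0, 0]" by (simp add: profile_def)
  then show ?thesis by (simp add: weight_def lookup_def weight_table_def)
qed

abbreviation reps :: "(7 \<Rightarrow> int) set" where
  "reps \<equiv> PiE UNIV (\<lambda>_. {-3..4})"

lemma weight_transform:
  fixes k :: "7 \<Rightarrow> int" and xs :: "7 list"
  assumes "distinct xs" "set xs = UNIV"
  shows "(\<Sum>v\<in>reps. of_real (weight v) * cis (- (2 * pi * (\<Sum>i\<in>UNIV. k i * v i) / 8))) =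
    complex_of_real (val (entry (fold (\<lambda>q. contract (class_chars q)) (map (\<lambda>i. dual_class (k i)) xs)
      (tabulate 4 7 weight_table)) [0, 0, 0, 0]))"
proof -
  define A where "A = tabulate 4 7 weight_table"
  have len: "length xs = 7" using distinct_card[OF assms(1)] assms(2) by simp
  have weight: "real_of_int (weight v) = val (entry A (profile UNIV v))" for v
  proof -
    have "sum_list (profile UNIV v) \<le> 7"
      using sum_list_profile_le[of "UNIV :: 7 set" v] by simp
    then have "entry A (profile UNIV v) = Zs (weight v) 0"
      unfolding weight_def A_def using weight_table_ok
      by (intro entry_tabulate) (auto simp: profile_def list_all_iff)
    then show ?thesis by simp
  qed
  have "(\<Sum>v\<in>reps. of_real (weight v) * cis (- (2 * pi * (\<Sum>i\<in>UNIV. k i * v i) / 8))) =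
      complex_of_real (transform (map (\<lambda>i. dual_class (k i)) xs) (\<lambda>c. val (entry A c)))"
    using weighted_character_sum[OF assms(1), of "\<lambda>c. val (entry A c)" k]
    by (simp add: assms(2) weight[symmetric])
  also have "transform (map (\<lambda>i. dual_class (k i)) xs) (\<lambda>c. val (entry A c)) =
      val (entry (fold (\<lambda>q. contract (class_chars q)) (map (\<lambda>i. dual_class (k i)) xs) A) [0, 0, 0, 0])"
    by (intro transform_contract) (simp add: A_def len shape_tabulate)
  finally show ?thesis by (simp only: A_def)
qed

text \<open>
  Sorting the coordinates by the class of their frequency makes the sequence of classes
  nondecreasing, so that it is one of those covered by the check.
\<close>
lemma weight_dual:
  fixes k :: "7 \<Rightarrow> int"
  shows "0 \<le> (\<Sum>v\<in>reps. of_real (weight v) * cis (- (2 * pi * (\<Sum>i\<in>UNIV. k i * v i) / 8)))"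
proof -
  obtain ys :: "7 list" where ys: "set ys = UNIV" "distinct ys"
    using finite_distinct_list[of "UNIV :: 7 set"] by auto
  define xs where "xs = sort_key (\<lambda>i. dual_class (k i)) ys"
  have xs: "distinct xs" "set xs = UNIV" by (simp_all add: xs_def ys)
  have "zsqrt2_nonneg (entry (fold (\<lambda>q. contract (class_chars q)) (map (\<lambda>i. dual_class (k i)) xs)
      (tabulate 4 7 weight_table)) [0, 0, 0, 0])"
  proof (rule dual_check_sound[OF weight_table_dual])
    show "set (map (\<lambda>i. dual_class (k i)) xs) \<subseteq> set [0, 1, 2, 3, 4]"
      unfolding set_map using dual_class_mem by blast
    show "sorted (map (\<lambda>i. dual_class (k i)) xs)" unfolding xs_def by (rule sorted_sort_key)
    show "length (map (\<lambda>i. dual_class (k i)) xs) = 7"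
      using distinct_card[OF xs(1)] xs(2) by simp
  qed simp
  then show ?thesis
    unfolding weight_transform[OF xs] using val_nonneg by (simp add: less_eq_complex_def)
qed

text \<open>The total mass is the value of the transform at frequency 0.\<close>
lemma weight_total: "(\<Sum>v\<in>reps. real_of_int (weight v)) = 104443824958625"
proof -
  obtain xs :: "7 list" where xs: "set xs = UNIV" "distinct xs"
    using finite_distinct_list[of "UNIV :: 7 set"] by auto
  have "length xs = 7" using distinct_card[OF xs(2)] xs(1) by simp
  then have zeros: "map (\<lambda>i. dual_class 0) xs = [0, 0, 0, 0, 0, 0, 0]"
    by (simp add: dual_class_def map_replicate_const numeral_eq_Suc)
  have "complex_of_real (\<Sum>v\<in>reps. real_of_int (weight v)) =
      complex_of_real (val (entry (fold (\<lambda>q. contract (class_chars q)) (map (\<lambda>i. dual_class 0) xs)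
        (tabulate 4 7 weight_table)) [0, 0, 0, 0]))"
    by (subst weight_transform[OF xs(2,1), of "\<lambda>_. 0", symmetric]) simp
  also have "\<dots> = complex_of_real 104443824958625"
    unfolding zeros weight_table_total by simp
  finally show ?thesis by (simp only: of_real_eq_iff)
qed

text \<open>
  The representatives in \<open>{-3..4}\<close> have the least absolute values in their classes, so it is enough to
  look at them, except for the class of the origin, whose other elements have a coordinate of
  absolute value at least 8.
\<close>
lemma weight_far:
  fixes v z :: "7 \<Rightarrow> int"
  assumes v: "v \<in> reps" "weight v \<noteq> 0" and z: "\<And>i. 8 dvd z i - v i" "z \<noteq> (\<lambda>_. 0)"
  shows "4 \<le> norm (\<chi> i. real_of_int (z i))"
proof -
  have range: "v i \<in> {-3..4}" for i using v(1) by (auto simp: PiE_iff)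
  have le: "(v i)\<^sup>2 \<le> (z i)\<^sup>2" for i
  proof -
    obtain q where "z i - v i = 8 * q" using z(1) by (auto simp: dvd_def)
    then have "\<bar>v i\<bar> \<le> \<bar>z i\<bar>" using range[of i] by (cases "q = 0"; cases "q > 0") auto
    then show ?thesis by (simp add: abs_le_square_iff)
  qed
  have "16 \<le> (\<Sum>i\<in>UNIV. (z i)\<^sup>2)"
  proof (cases "profile UNIV v = [7, 0, 0, 0]")
    case True
    then have "card {i. v i = 0} = card (UNIV :: 7 set)" by (simp add: profile_def)
    then have "{i. v i = 0} = UNIV" by (intro card_subset_eq) auto
    then have "v i = 0" for i by blast
    moreover obtain i where "z i \<noteq> 0" using z(2) by auto
    ultimately have "8 \<le> \<bar>z i\<bar>" using z(1)[of i] dvd_imp_le_int[of "z i" 8] by simp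
    then have "8\<^sup>2 \<le> (z i)\<^sup>2" using abs_le_square_iff[of 8 "z i"] by simp
    also have "\<dots> \<le> (\<Sum>i\<in>UNIV. (z i)\<^sup>2)" by (rule member_le_sum) auto
    finally show ?thesis by simp
  next
    case False
    then have "norm_defect (profile UNIV v) \<le> 96"
      using v(2) by (cases rule: weight_cases[of v]) auto
    then have "16 \<le> (\<Sum>i\<in>UNIV. (v i)\<^sup>2)"
      using sum_squares_profile[of UNIV v] range by simp
    also have "\<dots> \<le> (\<Sum>i\<in>UNIV. (z i)\<^sup>2)" by (intro sum_mono le)
    finally show ?thesis .
  qed
  then have "real_of_int 16 \<le> real_of_int (\<Sum>i\<in>UNIV. (z i)\<^sup>2)" by (simp only: of_int_le_iff)
  then have "4\<^sup>2 \<le> (norm (\<chi> i. real_of_int (z i)))\<^sup>2"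
    unfolding power2_norm_eq_inner inner_vec_def by (simp add: power2_eq_square)
  then show ?thesis by (rule power2_le_imp_le) simp
qed

lemma reps_dvd: "{v \<in> reps. \<forall>i. int 8 dvd v i} = {\<lambda>_. 0}"
proof (intro equalityI subsetI)
  fix v assume v: "v \<in> {v \<in> reps. \<forall>i. int 8 dvd v i}"
  have "v i = 0" for i
  proof -
    have "v i \<in> {-3..4}" "8 dvd v i" using v by (auto simp: PiE_iff)
    then show ?thesis by (auto simp: dvd_def)
  qed
  then show "v \<in> {\<lambda>_. 0}" by auto
qed (auto simp: PiE_iff)

text \<open>With \<open>m = 8\<close> and \<open>h = r/4\<close>, the factor \<open>(mh)\<^sup>7\<close> is \<open>4\<^sup>7 (r/2)\<^sup>7\<close>.\<close>
lemma admissible_lower_bound: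
  fixes f :: "real ^ 7 \<Rightarrow> real"
  assumes "r > 0" "admissible r f"
  shows "104443824958625 / 10 ^ 11 / 4 ^ 7 \<le> (r / 2) ^ 7 * f 0"
proof -
  have cont: "continuous_on UNIV f"
    using assms(2) unfolding admissible_def smooth_def by (metis Ck.simps(1))
  have "(\<Sum>v\<in>reps. real_of_int (weight v)) \<le> (real 8 * (r / 4)) ^ CARD(7) *
      (\<Sum>v\<in>{v \<in> reps. \<forall>i. int 8 dvd v i}. real_of_int (weight v)) * f 0"
  proof (rule discrete_dual_bound[of f r])
    show "finite reps" by (intro finite_PiE) auto
    show "r \<le> r / 4 * norm (\<chi> i. real_of_int (z i))"
      if "v \<in> reps" "real_of_int (weight v) \<noteq> 0" "\<And>i. int 8 dvd z i - v i" "z \<noteq> (\<lambda>_. 0)" for v z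
    proof -
      have "4 \<le> norm (\<chi> i. real_of_int (z i))"
        using that by (intro weight_far[of v]) auto
      then have "r / 4 * 4 \<le> r / 4 * norm (\<chi> i. real_of_int (z i))"
        using assms(1) by (intro mult_left_mono) auto
      then show ?thesis by simp
    qed
    show "0 \<le> (\<Sum>v\<in>reps. complex_of_real (real_of_int (weight v)) *
        cis (- (2 * pi * (\<Sum>i\<in>UNIV. k i * v i) / real 8)))" for k
      using weight_dual[of k] by simp
  qed (use assms cont in \<open>auto simp: admissible_def weight_nonneg\<close>)
  then have "104443824958625 \<le> (2 * r) ^ 7 * 10 ^ 11 * f 0"
    unfolding weight_total reps_dvd by (simp add: weight_0)
  then show ?thesis
    by (simp add: power_divide power_mult_distrib field_simps)
qed

theorem theorem8p2:
  fixes r :: real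
  assumes "r > 0"
  shows "cohn_elkies_bound TYPE(7) r > ereal 0.06374745"
proof -
  have "ereal 0.06374745 < ereal (104443824958625 / 10 ^ 11 / 4 ^ 7)"
    by simp
  also have "\<dots> \<le> cohn_elkies_bound TYPE(7) r"
    unfolding cohn_elkies_bound_def
    using admissible_lower_bound[OF assms] by (intro INF_greatest) simp
  finally show ?thesis .
qed

end
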